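(* There exist functions $(A_l)_{l\in\mathbb N\cup\{0\}}$ and $(B_l)_{l\in\mathbb N}$ of $z$, with $A_0=1/\sqrt{g}$, all analytic on $U$, such that for any $L\in\mathbb N\cup\{0\}$ the following holds. Let $w$ be one of the Airy functions $w_j$, $j\in\{0,1,2\}$. If we define $w_h(z)=w(h^{-2/3}\zeta(z))$, $w_h'(z)=w'(h^{-2/3}\zeta(z))$ and $$W(z)=h^{\frac13}w_h(z)\sum_{l=0}^{L}h^lA_l(z)+h^{\frac23}w_h'(z)\sum_{l=1}^{L}h^lB_l(z),$$ then one has $$H(W)=O\left(h^{L+2+\frac13}w_h\right)+O\left(h^{L+2+\frac23}w_h'\right).$$
   Context: Setting. $U\subset\mathbb C$ is an open disk centered at $z_0$, $v$ is analytic in $U$, $v(z_0)=-2$, $v'(z_0)\neq0$, and $v(z)\ne\pm2$ for $z\in U\setminus\{z_0\}$; $h>0$ is a small parameter (asymptotics as $h\to0$). The complex momentum $p$ is the multivalued function defined by $2\cos p(z)+v(z)=0$. Cut $U$ along a simple curve from $z_0$ to the boundary and choose a branch $p$ analytic in the cut disk with $p(z_0)=0$. Let $\zeta$ be an analytic branch of $z\mapsto\left(\frac{3}{2i}\int_{z_0}^zp(z')\,dz'\right)^{2/3}$; it is analytic in all of $U$, with $\zeta(z_0)=0$, $\zeta'(z_0)\ne0$. The disk $U$ is assumed small enough that $\zeta$ is a bi-analytic bijection of $U$ onto its image and that the function $g(z)=\sinh\left(\sqrt{\zeta(z)}\,\zeta'(z)\right)/\sqrt{\zeta(z)}$ (same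 branch of the root in both places; $g$ is analytic in $U$) does not vanish in $U$; $\sqrt g$ is an analytic branch in $U$. Airy functions: $w_j(\zeta)=2\pi i\,\omega^j\,\mathrm{Ai}(\omega^j\zeta)$, $\omega=e^{2\pi i/3}$, $j\in\{0,1,2\}$; they solve $w''(\zeta)=\zeta w(\zeta)$. Operator: $[H(f)](z)=f(z+h)+f(z-h)+v(z)f(z)$ whenever $\{z-h,z,z+h\}\subset U$. Convention: for functions $f_1,f_2$ on a set $D$, $f_2=O(f_1)$ in $D$ means $|f_2(z)|\le C|f_1(z)|$ for all $z\in D$, where $C$ is a positive constant independent of $z$ and $h$. Here the estimate is for $z$ with $\{z-h,z,z+h\}\subset U$, where $H(W)$ is defined.
   Formalization: The O-estimates are proved uniformly for {z-h,z,z+h} in each smaller concentric disk of radius r<R (C and the range of small h may depend on r), not on all of U, where uniformity can fail if v'' is unbounded near the boundary; A_l, B_l are analytic on all of U. *)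

theory Defs
  imports "HOL-Complex_Analysis.Complex_Analysis"
begin

text \<open>The Maclaurin series of the Airy function, with the standard values
  \<open>Ai(0) = 1 / (3^(2/3) \<Gamma>(2/3))\<close> and \<open>Ai'(0) = - 1 / (3^(1/3) \<Gamma>(1/3))\<close>. The factors
  \<open>3^k (1/3)_k = 1 \<cdot> 4 \<cdots> (3k-2)\<close> and \<open>3^k (2/3)_k = 2 \<cdot> 5 \<cdots> (3k-1)\<close> come from the recursion
  that \<open>w''(z) = z w(z)\<close> imposes on the coefficients.\<close>

definition Ai :: "complex \<Rightarrow> complex" where
  "Ai z =
     of_real (1 / (3 powr (2/3) * Gamma (2/3 :: real))) *
       (\<Sum>k. 3 ^ k * pochhammer (1/3) k / fact (3 * k) * z ^ (3 * k))
   - of_real (1 / (3 powr (1/3) * Gamma (1/3 :: real))) *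
       (\<Sum>k. 3 ^ k * pochhammer (2/3) k / fact (3 * k + 1) * z ^ (3 * k + 1))"

definition airy_omega :: complex where
  "airy_omega = exp (2 * of_real pi * \<i> / 3)"

definition airy_w :: "nat \<Rightarrow> complex \<Rightarrow> complex" where
  "airy_w j x = 2 * of_real pi * \<i> * airy_omega ^ j * Ai (airy_omega ^ j * x)"

definition diff_op :: "(complex \<Rightarrow> complex) \<Rightarrow> real \<Rightarrow> (complex \<Rightarrow> complex) \<Rightarrow> complex \<Rightarrow> complex" where
  "diff_op v h f z = f (z + of_real h) + f (z - of_real h) + v z * f z"

definition shift_dom :: "complex set \<Rightarrow> real \<Rightarrow> complex set" where
  "shift_dom U h = {z. {z - of_real h, z, z + of_real h} \<subseteq> U}"

definition cut_along :: "(real \<Rightarrow> complex) \<Rightarrow> complex \<Rightarrow> real \<Rightarrow> bool" where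
  "cut_along c z0 R \<longleftrightarrow> arc c \<and> pathstart c = z0 \<and> pathfinish c \<in> sphere z0 R \<and>
     path_image c - {pathfinish c} \<subseteq> ball z0 R"

text \<open>\<open>S z\<close> is the integral of \<open>p\<close> from \<open>z0\<close> to \<open>z\<close> within \<open>D\<close>. Since \<open>z0\<close> is a boundary point
  of the cut disk \<open>D\<close>, it is taken as the limit, as \<open>a\<close> tends to \<open>z0\<close> in \<open>D\<close>, of the integrals of
  \<open>p\<close> from \<open>a\<close> to \<open>z\<close>; no rectifiable path in \<open>D\<close> ending at \<open>z0\<close> is needed.\<close>

definition integral_from ::
    "complex set \<Rightarrow> complex \<Rightarrow> (complex \<Rightarrow> complex) \<Rightarrow> (complex \<Rightarrow> complex) \<Rightarrow> bool" where
  "integral_from D z0 p S \<longleftrightarrow>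
     (\<forall>q. valid_path q \<and> path_image q \<subseteq> D \<longrightarrow>
        (p has_contour_integral (S (pathfinish q) - S (pathstart q))) q) \<and>
     (S \<longlongrightarrow> 0) (at z0 within D)"

text \<open>\<open>x \<mapsto> sinh (x d) / x\<close> is even, so the choice of the square root of \<open>\<zeta> z\<close> is immaterial,
  and \<open>csqrt\<close> may be used pointwise. Where \<open>\<zeta> z = 0\<close> the singularity is removable, with
  value \<open>\<zeta>' z\<close>.\<close>

definition g_fun :: "(complex \<Rightarrow> complex) \<Rightarrow> complex \<Rightarrow> complex" where
  "g_fun \<zeta> z =
     (if \<zeta> z = 0 then deriv \<zeta> z
      else sinh (csqrt (\<zeta> z) * deriv \<zeta> z) / csqrt (\<zeta> z))"

text \<open>\<open>f2 = O(f1)\<close> for functions of \<open>h\<close> and \<open>z\<close>: a single constant serves all small \<open>h\<close> and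
  all \<open>z\<close> in the (\<open>h\<close>-dependent) domain \<open>D h\<close>.\<close>

definition unif_O ::
    "(real \<Rightarrow> complex set) \<Rightarrow> (real \<Rightarrow> complex \<Rightarrow> complex) \<Rightarrow> (real \<Rightarrow> complex \<Rightarrow> complex) \<Rightarrow> bool" where
  "unif_O D f2 f1 \<longleftrightarrow>
     (\<exists>C>0. \<exists>h0>0. \<forall>h\<in>{0<..<h0}. \<forall>z\<in>D h. norm (f2 h z) \<le> C * norm (f1 h z))"

text \<open>\<open>f = O(f1) + O(f2)\<close>.\<close>

definition unif_O_sum ::
    "(real \<Rightarrow> complex set) \<Rightarrow> (real \<Rightarrow> complex \<Rightarrow> complex) \<Rightarrow> (real \<Rightarrow> complex \<Rightarrow> complex) \<Rightarrow>
     (real \<Rightarrow> complex \<Rightarrow> complex) \<Rightarrow> bool" where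
  "unif_O_sum D f f1 f2 \<longleftrightarrow>
     (\<exists>F1 F2. (\<forall>h>0. \<forall>z\<in>D h. f h z = F1 h z + F2 h z) \<and> unif_O D F1 f1 \<and> unif_O D F2 f2)"

definition scaled :: "(complex \<Rightarrow> complex) \<Rightarrow> (complex \<Rightarrow> complex) \<Rightarrow> real \<Rightarrow> complex \<Rightarrow> complex" where
  "scaled w \<zeta> h z = w (of_real (h powr (-2/3)) * \<zeta> z)"

text \<open>The derivative is taken before rescaling: \<open>w_h'(z) = w'(h^(-2/3) \<zeta>(z))\<close>.\<close>

definition W_ansatz ::
    "(complex \<Rightarrow> complex) \<Rightarrow> (complex \<Rightarrow> complex) \<Rightarrow> (nat \<Rightarrow> complex \<Rightarrow> complex) \<Rightarrow>
     (nat \<Rightarrow> complex \<Rightarrow> complex) \<Rightarrow> nat \<Rightarrow> real \<Rightarrow> complex \<Rightarrow> complex" where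
  "W_ansatz w \<zeta> A B L h z =
     of_real (h powr (1/3)) * scaled w \<zeta> h z * (\<Sum>l=0..L. of_real (h ^ l) * A l z)
   + of_real (h powr (2/3)) * scaled (deriv w) \<zeta> h z * (\<Sum>l=1..L. of_real (h ^ l) * B l z)"

end

theory Submission
  imports Defs
begin

text \<open>Let \<open>w\<close> be an Airy function. Along the straight segment from \<open>\<zeta> z\<close> to \<open>\<zeta> (z + h)\<close>, parametrised as
\<open>x + h s\<close> with \<open>x = \<zeta> z\<close>, the rescaled function \<open>w (h powr (-2/3) * (x + h * s))\<close> solves
\<open>y'' = (x + h s) y\<close> in the variable \<open>s\<close>. The fundamental solutions of this equation are entire in \<open>s\<close>, \<open>x\<close>
and \<open>h\<close>, and at \<open>h = 0\<close> they are \<open>cosh (sqrt x * s)\<close> and \<open>sinh (sqrt x * s) / sqrt x\<close>. Consequently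
(\<open>airy_transport\<close>) the pair \<open>w_h, w_h'\<close> at \<open>z + h\<close> and at \<open>z - h\<close> is an exact linear combination, up to
powers of \<open>h powr (1/3)\<close>, of the pair at \<open>z\<close>, with coefficients
\<open>a, b, c, d\<close> analytic in \<open>z\<close> and \<open>h\<close>. Applying the operator to the ansatz gives \<open>w_h\<close> and \<open>w_h'\<close> times two
functions analytic in \<open>z\<close> and \<open>h\<close> (\<open>diff_op_W_ansatz\<close>), and it suffices to choose the amplitudes so that
these two functions vanish to order \<open>L + 2\<close> at \<open>h = 0\<close>.

The leading coefficient in both is \<open>2 cosh (sqrt \<zeta> * \<zeta>') + v\<close>, which vanishes by the choice of \<open>\<zeta>\<close>
(\<open>phase_dispersion\<close>). Because the operator treats \<open>h\<close> and \<open>-h\<close> alike, parity removes half of the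
remaining terms, and at each further order one amplitude \<open>A\<close> and one amplitude \<open>B\<close> have to solve
(\<open>coupled_expansion\<close>)

  \<open>b0 A' + b1 A = (known)\<close> and \<open>c0 B' + c1 B = (known)\<close>,

where \<open>b0 = g\<close> and \<open>c0 = \<zeta> g\<close> are the values of \<open>b\<close> and \<open>c\<close> at \<open>h = 0\<close>, and \<open>b1\<close>, \<open>c1\<close> their first
\<open>h\<close>-derivatives there. A step and the step back have the same \<open>b\<close> and \<open>c\<close>, by constancy of the
Wronskian, so \<open>b1 = b0' / 2\<close> and \<open>c1 = c0' / 2\<close> (\<open>lin_sol_reverse\<close>, \<open>deriv_symmetric\<close>). The first
equation is solved by \<open>A0 = 1 / sqrt g\<close> when its right-hand side is zero, and by one integration in
general. The second is singular at \<open>z0\<close>, where \<open>\<zeta>\<close> has a simple zero, but its exponent there is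
\<open>-1/2\<close>; since this is not a nonnegative integer, an analytic solution exists for every analytic right-hand
side (\<open>transport_singular\<close>). The induction over the orders is \<open>formal_solution\<close>.

For the estimate, "vanishing to order \<open>N\<close>" is expressed as divisibility by \<open>h ^ N\<close> within a class of
functions of \<open>(z, h)\<close> that are bounded on compact parts of \<open>|z - z0| + |h| < R\<close>. The class is closed
under division by \<open>h\<close> (\<open>holo2_hquot\<close>), so uniform bounds come with the construction.\<close>

section \<open>Functions of position and step, holomorphic in each\<close>

text \<open>All functions of the position \<open>z\<close> and the step \<open>h\<close> live on the domain
\<open>|z - z0| + |h| < R\<close>, where \<open>z\<close> and \<open>z + h\<close> both stay in the disk. Separate holomorphy together
with local boundedness is ordinary holomorphy in two variables; it is taken in this form because
each part passes easily through products, locally uniform limits and division by \<open>h\<close>. The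
bounds on \<open>|z - z0| \<le> r\<close>, \<open>|h| \<le> \<rho>\<close> are what the final uniform estimate consists of.\<close>

definition holo2 :: "complex \<Rightarrow> real \<Rightarrow> (complex \<Rightarrow> complex \<Rightarrow> complex) \<Rightarrow> bool" where
  "holo2 z0 R F \<longleftrightarrow>
     (\<forall>z\<in>ball z0 R. F z holomorphic_on ball 0 (R - dist z0 z)) \<and>
     (\<forall>h\<in>ball 0 R. (\<lambda>z. F z h) holomorphic_on ball z0 (R - norm h)) \<and>
     (\<forall>r \<rho>. r + \<rho> < R \<longrightarrow>
        (\<exists>M. \<forall>z\<in>cball z0 r. \<forall>h\<in>cball 0 \<rho>. norm (F z h) \<le> M))"

lemma holo2D1: "holo2 z0 R F \<Longrightarrow> z \<in> ball z0 R \<Longrightarrow> F z holomorphic_on ball 0 (R - dist z0 z)"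
  and holo2D2: "holo2 z0 R F \<Longrightarrow> norm h < R \<Longrightarrow> (\<lambda>z. F z h) holomorphic_on ball z0 (R - norm h)"
  by (auto simp: holo2_def)

lemma holo2_bound:
  assumes "holo2 z0 R F" "r + \<rho> < R"
  obtains M where "M > 0" "\<And>z h. z \<in> cball z0 r \<Longrightarrow> h \<in> cball 0 \<rho> \<Longrightarrow> norm (F z h) \<le> M"
proof -
  obtain M where M: "\<forall>z\<in>cball z0 r. \<forall>h\<in>cball 0 \<rho>. norm (F z h) \<le> M"
    using assms unfolding holo2_def by blast
  show ?thesis
    by (rule that[of "\<bar>M\<bar> + 1"]) (use M in force)+
qed

lemma holo2_at_0: "holo2 z0 R F \<Longrightarrow> R > 0 \<Longrightarrow> (\<lambda>z. F z 0) holomorphic_on ball z0 R"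
  using holo2D2[of z0 R F 0] by simp

lemma holo2_add:
  assumes "holo2 z0 R F" "holo2 z0 R G"
  shows "holo2 z0 R (\<lambda>z h. F z h + G z h)"
  unfolding holo2_def
proof (intro conjI ballI allI impI)
  fix r \<rho> :: real assume "r + \<rho> < R"
  obtain M where M: "\<And>z h. z \<in> cball z0 r \<Longrightarrow> h \<in> cball 0 \<rho> \<Longrightarrow> norm (F z h) \<le> M"
    using holo2_bound[OF assms(1) \<open>r + \<rho> < R\<close>] by metis
  obtain N where N: "\<And>z h. z \<in> cball z0 r \<Longrightarrow> h \<in> cball 0 \<rho> \<Longrightarrow> norm (G z h) \<le> N"
    using holo2_bound[OF assms(2) \<open>r + \<rho> < R\<close>] by metis
  show "\<exists>M. \<forall>z\<in>cball z0 r. \<forall>h\<in>cball 0 \<rho>. norm (F z h + G z h) \<le> M"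
    by (intro exI[of _ "M + N"] ballI order.trans[OF norm_triangle_ineq] add_mono M N)
qed (use assms in \<open>auto simp: holo2_def intro!: holomorphic_intros\<close>)

lemma holo2_mult:
  assumes "holo2 z0 R F" "holo2 z0 R G"
  shows "holo2 z0 R (\<lambda>z h. F z h * G z h)"
  unfolding holo2_def
proof (intro conjI ballI allI impI)
  fix r \<rho> :: real assume "r + \<rho> < R"
  obtain M where "M > 0" and M: "\<And>z h. z \<in> cball z0 r \<Longrightarrow> h \<in> cball 0 \<rho> \<Longrightarrow> norm (F z h) \<le> M"
    using holo2_bound[OF assms(1) \<open>r + \<rho> < R\<close>] by metis
  obtain N where N: "\<And>z h. z \<in> cball z0 r \<Longrightarrow> h \<in> cball 0 \<rho> \<Longrightarrow> norm (G z h) \<le> N"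
    using holo2_bound[OF assms(2) \<open>r + \<rho> < R\<close>] by metis
  show "\<exists>M. \<forall>z\<in>cball z0 r. \<forall>h\<in>cball 0 \<rho>. norm (F z h * G z h) \<le> M"
    unfolding norm_mult using \<open>M > 0\<close>
    by (intro exI[of _ "M * N"] ballI mult_mono M N) auto
qed (use assms in \<open>auto simp: holo2_def intro!: holomorphic_intros\<close>)

lemma holo2_shift:
  assumes f: "f holomorphic_on ball z0 R"
  shows "holo2 z0 R (\<lambda>z h. f (z + h))"
  unfolding holo2_def
proof (intro conjI ballI allI impI)
  fix z assume "z \<in> ball z0 R"
  show "(\<lambda>h. f (z + h)) holomorphic_on ball 0 (R - dist z0 z)"
  proof (rule holomorphic_on_compose_gen[of "\<lambda>h. z + h" _ f "ball z0 R", unfolded o_def])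
    show "(\<lambda>h::complex. z + h) ` ball 0 (R - dist z0 z) \<subseteq> ball z0 R"
    proof clarify
      fix h :: complex assume "h \<in> ball 0 (R - dist z0 z)"
      then show "z + h \<in> ball z0 R"
        using dist_triangle[of z0 "z + h" z] by (simp add: dist_norm)
    qed
  qed (auto intro!: holomorphic_intros f)
next
  fix h :: complex assume "h \<in> ball 0 R"
  show "(\<lambda>z. f (z + h)) holomorphic_on ball z0 (R - norm h)"
  proof (rule holomorphic_on_compose_gen[of "\<lambda>z. z + h" _ f "ball z0 R", unfolded o_def])
    show "(\<lambda>z. z + h) ` ball z0 (R - norm h) \<subseteq> ball z0 R"
    proof clarify
      fix z assume "z \<in> ball z0 (R - norm h)"
      then show "z + h \<in> ball z0 R"
        using dist_triangle[of z0 "z + h" z] by (simp add: dist_norm)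
    qed
  qed (auto intro!: holomorphic_intros f)
next
  fix r \<rho> :: real assume "r + \<rho> < R"
  have "continuous_on (cball z0 (r + \<rho>)) f"
    using \<open>r + \<rho> < R\<close>
    by (intro holomorphic_on_imp_continuous_on holomorphic_on_subset[OF f]) auto
  then have "bounded (f ` cball z0 (r + \<rho>))"
    by (intro compact_imp_bounded compact_continuous_image) auto
  then obtain M where M: "\<And>z. z \<in> cball z0 (r + \<rho>) \<Longrightarrow> norm (f z) \<le> M"
    unfolding bounded_iff by blast
  have "norm (f (z + h)) \<le> M" if "z \<in> cball z0 r" "h \<in> cball 0 \<rho>" for z h
    using that dist_triangle[of z0 "z + h" z] by (intro M) (simp add: dist_norm)
  then show "\<exists>M. \<forall>z\<in>cball z0 r. \<forall>h\<in>cball 0 \<rho>. norm (f (z + h)) \<le> M" by blast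
qed

lemma holo2_fst:
  assumes f: "f holomorphic_on ball z0 R"
  shows "holo2 z0 R (\<lambda>z h. f z)"
  unfolding holo2_def
proof (intro conjI ballI allI impI)
  fix h :: complex assume "h \<in> ball 0 R"
  show "f holomorphic_on ball z0 (R - norm h)"
    by (rule holomorphic_on_subset[OF f]) (simp add: subset_ball)
next
  fix r \<rho> :: real assume "r + \<rho> < R"
  obtain M where M: "M > 0"
      "\<And>z h. z \<in> cball z0 r \<Longrightarrow> h \<in> cball 0 \<rho> \<Longrightarrow> norm (f (z + h)) \<le> M"
    using holo2_bound[OF holo2_shift[OF f] \<open>r + \<rho> < R\<close>] by metis
  show "\<exists>M. \<forall>z\<in>cball z0 r. \<forall>h\<in>cball 0 \<rho>. norm (f z) \<le> M"
    using M(2)[of _ 0] by (cases "\<rho> \<ge> 0") (auto intro!: exI[of _ M])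
qed auto

lemma holo2_const: "holo2 z0 R (\<lambda>z h. k)"
  by (rule holo2_fst) auto

lemma holo2_snd: "holo2 z0 R (\<lambda>z h. h)"
  unfolding holo2_def by (auto intro!: holomorphic_intros)

lemma holo2_flip:
  assumes F: "holo2 z0 R F"
  shows "holo2 z0 R (\<lambda>z h. F z (- h))"
  unfolding holo2_def
proof (intro conjI ballI allI impI)
  fix z assume "z \<in> ball z0 R"
  show "(\<lambda>h. F z (- h)) holomorphic_on ball 0 (R - dist z0 z)"
    by (rule holomorphic_on_compose_gen[of uminus _ "F z", unfolded o_def,
          OF _ holo2D1[OF F \<open>z \<in> ball z0 R\<close>]])
       (auto intro!: holomorphic_intros)
next
  fix h :: complex assume "h \<in> ball 0 R"
  then show "(\<lambda>z. F z (- h)) holomorphic_on ball z0 (R - norm h)"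
    using holo2D2[OF F, of "-h"] by simp
next
  fix r \<rho> :: real assume "r + \<rho> < R"
  obtain M where M: "M > 0" "\<And>z h. z \<in> cball z0 r \<Longrightarrow> h \<in> cball 0 \<rho> \<Longrightarrow> norm (F z h) \<le> M"
    using holo2_bound[OF F \<open>r + \<rho> < R\<close>] by metis
  show "\<exists>M. \<forall>z\<in>cball z0 r. \<forall>h\<in>cball 0 \<rho>. norm (F z (- h)) \<le> M"
    by (rule exI[of _ M]) (auto intro!: M)
qed

lemma holo2_minus: "holo2 z0 R F \<Longrightarrow> holo2 z0 R (\<lambda>z h. - F z h)"
  using holo2_mult[OF holo2_const[of z0 R "-1"], of F] by simp

lemma holo2_diff: "holo2 z0 R F \<Longrightarrow> holo2 z0 R G \<Longrightarrow> holo2 z0 R (\<lambda>z h. F z h - G z h)"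
  using holo2_add[OF _ holo2_minus, of z0 R F G] by simp

lemma holo2_power: "holo2 z0 R F \<Longrightarrow> holo2 z0 R (\<lambda>z h. F z h ^ n)"
  by (induction n) (auto intro: holo2_const holo2_mult)

lemma holo2_sum: "(\<And>i. i \<in> I \<Longrightarrow> holo2 z0 R (F i)) \<Longrightarrow> holo2 z0 R (\<lambda>z h. \<Sum>i\<in>I. F i z h)"
  by (induction I rule: infinite_finite_induct) (auto intro: holo2_const holo2_add)

lemmas holo2_intros = holo2_add holo2_mult holo2_const holo2_snd holo2_minus holo2_diff
  holo2_power holo2_sum

text \<open>The Weierstrass test on compact parts of the domain. It brings the solutions of the
linear-potential equation, which are given by infinite series, into the class.\<close>

lemma holo2_suminf:
  assumes F: "\<And>n. holo2 z0 R (F n)"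
    and M: "\<And>r \<rho>. r + \<rho> < R \<Longrightarrow> \<exists>M. summable M \<and>
              (\<forall>n. \<forall>z\<in>cball z0 r. \<forall>h\<in>cball 0 \<rho>. norm (F n z h) \<le> M n)"
  shows "holo2 z0 R (\<lambda>z h. \<Sum>n. F n z h)"
  unfolding holo2_def
proof (intro conjI ballI allI impI)
  fix z assume z: "z \<in> ball z0 R"
  show "(\<lambda>h. \<Sum>n. F n z h) holomorphic_on ball 0 (R - dist z0 z)"
  proof (rule holomorphic_uniform_sequence[where f = "\<lambda>N h. \<Sum>n<N. F n z h"])
    show "(\<lambda>h. \<Sum>n<N. F n z h) holomorphic_on ball 0 (R - dist z0 z)" for N
      by (intro holomorphic_intros holo2D1[OF F z])
    fix h :: complex assume h: "h \<in> ball 0 (R - dist z0 z)"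
    define d where "d = (R - dist z0 z - norm h) / 2"
    have d: "d > 0" "dist z0 z + (norm h + d) < R" using h by (auto simp: d_def field_simps)
    obtain M where M': "summable M"
      "\<And>n z' h'. z' \<in> cball z0 (dist z0 z) \<Longrightarrow> h' \<in> cball 0 (norm h + d) \<Longrightarrow> norm (F n z' h') \<le> M n"
      using M[OF d(2)] by auto
    have sub: "cball h d \<subseteq> cball 0 (norm h + d)"
      by (auto simp: dist_norm) (smt (verit) norm_triangle_sub norm_minus_commute)
    have "uniform_limit (cball h d) (\<lambda>N h. \<Sum>n<N. F n z h) (\<lambda>h. \<Sum>n. F n z h) sequentially"
      by (rule Weierstrass_m_test_ev[OF _ M'(1)]) (use sub in \<open>auto intro!: always_eventually M'(2)\<close>)
    moreover have "cball h d \<subseteq> ball 0 (R - dist z0 z)"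
      using sub d by (auto simp: subset_iff) 
    ultimately show "\<exists>d>0. cball h d \<subseteq> ball 0 (R - dist z0 z) \<and>
        uniform_limit (cball h d) (\<lambda>N h. \<Sum>n<N. F n z h) (\<lambda>h. \<Sum>n. F n z h) sequentially"
      using d(1) by blast
  qed auto
next
  fix h :: complex assume h: "h \<in> ball 0 R"
  show "(\<lambda>z. \<Sum>n. F n z h) holomorphic_on ball z0 (R - norm h)"
  proof (rule holomorphic_uniform_sequence[where f = "\<lambda>N z. \<Sum>n<N. F n z h"])
    show "(\<lambda>z. \<Sum>n<N. F n z h) holomorphic_on ball z0 (R - norm h)" for N
      using h by (intro holomorphic_intros holo2D2[OF F]) auto
    fix z assume z: "z \<in> ball z0 (R - norm h)"
    define d where "d = (R - dist z0 z - norm h) / 2"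
    have d: "d > 0" "(dist z0 z + d) + norm h < R" using z by (auto simp: d_def field_simps)
    obtain M where M': "summable M"
      "\<And>n z' h'. z' \<in> cball z0 (dist z0 z + d) \<Longrightarrow> h' \<in> cball 0 (norm h) \<Longrightarrow> norm (F n z' h') \<le> M n"
      using M[OF d(2)] by auto
    have sub: "cball z d \<subseteq> cball z0 (dist z0 z + d)"
      by (simp add: cball_subset_cball_iff dist_commute)
    have "uniform_limit (cball z d) (\<lambda>N z. \<Sum>n<N. F n z h) (\<lambda>z. \<Sum>n. F n z h) sequentially"
      by (rule Weierstrass_m_test_ev[OF _ M'(1)]) (use sub in \<open>auto intro!: always_eventually M'(2)\<close>)
    moreover have "cball z d \<subseteq> ball z0 (R - norm h)"
      using sub d by (auto simp: subset_iff) 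
    ultimately show "\<exists>d>0. cball z d \<subseteq> ball z0 (R - norm h) \<and>
        uniform_limit (cball z d) (\<lambda>N z. \<Sum>n<N. F n z h) (\<lambda>z. \<Sum>n. F n z h) sequentially"
      using d(1) by blast
  qed auto
next
  fix r \<rho> :: real assume "r + \<rho> < R"
  then obtain M where M': "summable M"
      "\<And>n z h. z \<in> cball z0 r \<Longrightarrow> h \<in> cball 0 \<rho> \<Longrightarrow> norm (F n z h) \<le> M n"
    using M by metis
  have "norm (\<Sum>n. F n z h) \<le> (\<Sum>n. M n)" if "z \<in> cball z0 r" "h \<in> cball 0 \<rho>" for z h
    by (rule norm_suminf_le[OF M'(2)[OF that] M'(1)])
  then show "\<exists>M. \<forall>z\<in>cball z0 r. \<forall>h\<in>cball 0 \<rho>. norm (\<Sum>n. F n z h) \<le> M" by blast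
qed

text \<open>The difference quotient in \<open>h\<close> at \<open>0\<close>, completed by its limit. The recursion
\<open>F z h = F z 0 + h * hquot F z h\<close> replaces Taylor expansion with remainder: "of order \<open>h^N\<close>" means
"\<open>h^N\<close> times a member of the class".\<close>

definition hquot :: "(complex \<Rightarrow> complex \<Rightarrow> complex) \<Rightarrow> complex \<Rightarrow> complex \<Rightarrow> complex" where
  "hquot F z h = (if h = 0 then deriv (F z) 0 else (F z h - F z 0) / h)"

lemma hquot_eq: "F z h = F z 0 + h * hquot F z h"
  by (simp add: hquot_def)

lemma hquot_0: "hquot F z 0 = deriv (F z) 0"
  by (simp add: hquot_def)

text \<open>The maximum principle moves the estimate to the circle \<open>|h| = \<rho>\<close>, away from the removable
singularity. A bound for \<open>f\<close> therefore also bounds the quotient, on the same disk.\<close>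

lemma norm_diff_quotient_le:
  fixes f :: "complex \<Rightarrow> complex"
  assumes f: "f holomorphic_on ball 0 s" and "0 < \<rho>" "\<rho> < s"
    and M: "\<And>h. norm h \<le> \<rho> \<Longrightarrow> norm (f h) \<le> M"
    and h: "norm h \<le> \<rho>"
  shows "norm (if h = 0 then deriv f 0 else (f h - f 0) / h) \<le> 2 * M / \<rho>"
proof -
  let ?q = "\<lambda>h. if h = 0 then deriv f 0 else (f h - f 0) / h"
  have q: "?q holomorphic_on ball 0 s"
    using pole_lemma_open[OF f, of 0] by (simp cong: if_cong)
  show ?thesis
  proof (rule maximum_modulus_frontier[of ?q "cball 0 \<rho>"])
    show "?q holomorphic_on interior (cball 0 \<rho>)"
      using assms by (intro holomorphic_on_subset[OF q]) auto
    show "continuous_on (closure (cball 0 \<rho>)) ?q"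
      using assms by (intro holomorphic_on_imp_continuous_on holomorphic_on_subset[OF q]) auto
    fix k :: complex assume "k \<in> frontier (cball 0 \<rho>)"
    then have k: "norm k = \<rho>" by (simp add: frontier_cball)
    have "norm (f k - f 0) \<le> M + M"
      using k \<open>0 < \<rho>\<close> by (intro order.trans[OF norm_triangle_ineq4] add_mono M) auto
    then show "norm (?q k) \<le> 2 * M / \<rho>"
      using k \<open>0 < \<rho>\<close> by (auto simp: norm_divide divide_right_mono)
  qed (use h in auto)
qed

text \<open>Boundedness is the previous lemma. The delicate point is holomorphy in \<open>z\<close> at \<open>h = 0\<close>: there the quotient is the uniform limit of the
quotients at a sequence of nonzero steps. The rate of convergence is the bound for the second
quotient, the quotient of the quotient.\<close>

lemma holo2_hquot:
  assumes F: "holo2 z0 R F"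
  shows "holo2 z0 R (hquot F)"
proof -
  have hol1: "hquot F z holomorphic_on ball 0 (R - dist z0 z)" if "z \<in> ball z0 R" for z
    using pole_lemma_open[OF holo2D1[OF F that], of 0] by (simp add: hquot_def[abs_def] cong: if_cong)
  have bnd: "\<exists>M. \<forall>z\<in>cball z0 r. \<forall>h\<in>cball 0 \<rho>. norm (hquot F z h) \<le> M"
    if rho: "r + \<rho> < R" for r \<rho>
  proof (cases "r \<ge> 0 \<and> \<rho> \<ge> 0")
    case True
    \<comment> \<open>A radius strictly between \<open>\<rho>\<close> and \<open>R - r\<close>, positive even if \<open>\<rho> = 0\<close>.\<close>
    define \<sigma> where "\<sigma> = \<rho> + (R - r - \<rho>) / 2"
    have \<sigma>: "\<rho> < \<sigma>" "0 < \<sigma>" "r + \<sigma> < R" using rho True by (auto simp: \<sigma>_def field_simps)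
    obtain M where M: "M > 0" "\<And>z h. z \<in> cball z0 r \<Longrightarrow> h \<in> cball 0 \<sigma> \<Longrightarrow> norm (F z h) \<le> M"
      using holo2_bound[OF F \<sigma>(3)] by metis
    have "norm (hquot F z h) \<le> 2 * M / \<sigma>" if "z \<in> cball z0 r" "h \<in> cball 0 \<rho>" for z h
      unfolding hquot_def
      by (rule norm_diff_quotient_le[OF holo2D1[OF F, of z]])
         (use that \<sigma> True in \<open>auto intro!: M\<close>)
    then show ?thesis by blast
  qed auto
  have hol2: "(\<lambda>z. hquot F z h) holomorphic_on ball z0 (R - norm h)" if h: "norm h < R" for h
  proof (cases "h = 0")
    case False
    have R: "R > 0" using h norm_ge_zero[of h] by linarith
    have "(\<lambda>z. (F z h - F z 0) / h) holomorphic_on ball z0 (R - norm h)"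
      using False
      by (intro holomorphic_intros holo2D2[OF F h] holomorphic_on_subset[OF holo2_at_0[OF F R]]) (auto simp: subset_ball)
    with False show ?thesis by (simp add: hquot_def[abs_def])
  next
    case True
    then have R: "R > 0" using h by simp
    have "(\<lambda>z. hquot F z 0) holomorphic_on ball z0 R"
    proof (rule holomorphic_on_subset[of _ "\<Union>r\<in>{0<..<R}. ball z0 r"])
      show "ball z0 R \<subseteq> (\<Union>r\<in>{0<..<R}. ball z0 r)"
      proof
        fix z assume "z \<in> ball z0 R"
        then have "(dist z0 z + R) / 2 \<in> {0<..<R}" "z \<in> ball z0 ((dist z0 z + R) / 2)"
          using R zero_le_dist[of z0 z] by (auto simp: field_simps simp del: zero_le_dist)
        then show "z \<in> (\<Union>r\<in>{0<..<R}. ball z0 r)" by blast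
      qed
      show "(\<lambda>z. hquot F z 0) holomorphic_on (\<Union>r\<in>{0<..<R}. ball z0 r)"
      proof (rule holomorphic_on_UN_open)
        fix r assume r: "r \<in> {0<..<R}"
        define \<rho> where "\<rho> = (R - r) / 2"
        have \<rho>: "\<rho> > 0" "r + \<rho> < R" using r by (auto simp: \<rho>_def field_simps)
        obtain M where M: "\<And>z h. z \<in> cball z0 r \<Longrightarrow> h \<in> cball 0 \<rho> \<Longrightarrow> norm (hquot F z h) \<le> M"
          using bnd[OF \<rho>(2)] by blast
        \<comment> \<open>Steps that tend to \<open>0\<close> but never vanish and never exceed \<open>\<rho>\<close>.\<close>
        define hn :: "nat \<Rightarrow> complex" where "hn n = of_real (\<rho> / real (n + 1))" for n
        have hn: "hn n \<noteq> 0" "norm (hn n) \<le> \<rho>" "norm (hn n) = \<rho> / real (n + 1)" for n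
        proof -
          show eq: "norm (hn n) = \<rho> / real (n + 1)"
            using \<rho> unfolding hn_def norm_of_real by simp
          show "hn n \<noteq> 0" using \<rho> unfolding hn_def of_real_eq_0_iff by simp
          have "\<rho> * 1 \<le> \<rho> * real (n + 1)" using \<rho> by (intro mult_left_mono) auto
          then show "norm (hn n) \<le> \<rho>" unfolding eq by (simp add: field_simps)
        qed
        show "(\<lambda>z. hquot F z 0) holomorphic_on ball z0 r"
        proof (rule holomorphic_uniform_sequence[where f = "\<lambda>n z. (F z (hn n) - F z 0) / hn n"])
          fix n
          have "norm (hn n) < R" using hn(2)[of n] \<rho> r by auto
          moreover have "r \<le> R - norm (hn n)" using hn(2)[of n] \<rho> by auto
          ultimately show "(\<lambda>z. (F z (hn n) - F z 0) / hn n) holomorphic_on ball z0 r"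
            using r hn(1)
            by (intro holomorphic_intros holomorphic_on_subset[OF holo2D2[OF F, of "hn n"]]
                holomorphic_on_subset[OF holo2_at_0[OF F R]]) auto
        next
          have lim: "uniform_limit (ball z0 r) (\<lambda>n z. (F z (hn n) - F z 0) / hn n)
                       (\<lambda>z. hquot F z 0) sequentially"
          proof (rule uniform_limitI)
            fix e :: real assume "e > 0"
            have "((\<lambda>n. 2 * M / real (n + 1)) \<longlongrightarrow> 0) sequentially" by real_asymp
            then have "\<forall>\<^sub>F n in sequentially. 2 * M / real (n + 1) < e"
              using \<open>e > 0\<close> by (rule order_tendstoD)
            then show "\<forall>\<^sub>F n in sequentially. \<forall>z\<in>ball z0 r.
                dist ((F z (hn n) - F z 0) / hn n) (hquot F z 0) < e"
            proof (rule eventually_mono, intro ballI)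
              fix n z assume n: "2 * M / real (n + 1) < e" and z: "z \<in> ball z0 r"
              have zR: "z \<in> ball z0 R" "\<rho> < R - dist z0 z" using z r \<rho> by auto
              have "norm (if hn n = 0 then deriv (hquot F z) 0
                      else (hquot F z (hn n) - hquot F z 0) / hn n) \<le> 2 * M / \<rho>"
                by (rule norm_diff_quotient_le[OF hol1[OF zR(1)] \<rho>(1) zR(2)])
                   (use z hn(2)[of n] in \<open>auto intro!: M\<close>)
              then have "norm (hquot F z (hn n) - hquot F z 0) \<le> 2 * M / \<rho> * norm (hn n)"
                using hn(1)[of n] by (simp add: norm_divide pos_divide_le_eq)
              also have "\<dots> = 2 * M / real (n + 1)"
                using \<rho> unfolding hn(3) by simp
              finally have "norm (hquot F z (hn n) - hquot F z 0) \<le> 2 * M / real (n + 1)" .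
              then show "dist ((F z (hn n) - F z 0) / hn n) (hquot F z 0) < e"
                using n hn(1)[of n] by (simp add: dist_norm hquot_def)
            qed
          qed
          fix z assume "z \<in> ball z0 r"
          then obtain d where d: "d > 0" "cball z d \<subseteq> ball z0 r"
            using open_contains_cball open_ball by blast
          then show "\<exists>d>0. cball z d \<subseteq> ball z0 r \<and>
             uniform_limit (cball z d) (\<lambda>n z. (F z (hn n) - F z 0) / hn n)
               (\<lambda>z. hquot F z 0) sequentially"
            using uniform_limit_on_subset[OF lim] by blast
        qed auto
      qed auto
    qed
    with True show ?thesis by simp
  qed
  show ?thesis unfolding holo2_def using hol1 hol2 bnd by auto
qed

lemma holo2_has_field_derivative:
  assumes "holo2 z0 R F" "z \<in> ball z0 R"
  shows "(F z has_field_derivative deriv (F z) 0) (at 0)"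
  using assms holomorphic_derivI[OF holo2D1[OF assms], of 0] by simp

lemma taylor2_eq:
  "F z h = F z 0 + h * deriv (F z) 0 + h\<^sup>2 * hquot (hquot F) z h"
proof -
  have "F z h = F z 0 + h * hquot F z h" by (rule hquot_eq)
  also have "hquot F z h = hquot F z 0 + h * hquot (hquot F) z h" by (rule hquot_eq)
  finally show ?thesis by (simp add: hquot_0 algebra_simps power2_eq_square)
qed

text \<open>If a coefficient does not change when a step is traversed backwards, it is an even function of
\<open>h\<close> about the midpoint \<open>z + h/2\<close>. Its first \<open>h\<close>-derivative is therefore half of the derivative of
its value at \<open>h = 0\<close>. This gives the transport equations below their self-adjoint form
\<open>c f' + c' f / 2\<close>.\<close>

lemma deriv_symmetric:
  assumes F: "holo2 z0 R F" and sym: "\<And>z h. F (z + h) (- h) = F z h" and z: "z \<in> ball z0 R"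
  shows "deriv (\<lambda>z. F z 0) z = 2 * deriv (F z) 0"
proof (rule DERIV_imp_deriv)
  define K where "K = hquot (hquot F)"
  define F1 where "F1 z = deriv (F z) 0" for z
  have R: "R > 0" using z zero_le_dist[of z0 z] unfolding mem_ball by linarith
  have K: "holo2 z0 R K" unfolding K_def by (intro holo2_hquot F)
  define \<rho> where "\<rho> = (R - dist z0 z) / 4"
  have \<rho>: "\<rho> > 0" "(dist z0 z + \<rho>) + \<rho> < R" using z by (auto simp: \<rho>_def field_simps)
  obtain M where M: "M > 0" "\<And>z' h. z' \<in> cball z0 (dist z0 z + \<rho>) \<Longrightarrow> h \<in> cball 0 \<rho> \<Longrightarrow> norm (K z' h) \<le> M"
    using holo2_bound[OF K \<rho>(2)] by metis
  have eq: "(F (z + h) 0 - F z 0) / h = F1 z + F1 (z + h) + h * (K z h - K (z + h) (- h))"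
    if "h \<noteq> 0" for h
  proof -
    have "F (z + h) 0 + (- h) * F1 (z + h) + (- h)\<^sup>2 * K (z + h) (- h)
            = F z 0 + h * F1 z + h\<^sup>2 * K z h"
      using sym[of z h] taylor2_eq[of F "z + h" "- h"] taylor2_eq[of F z h]
      unfolding F1_def K_def by simp
    then have "F (z + h) 0 - F z 0 = h * (F1 z + F1 (z + h) + h * (K z h - K (z + h) (- h)))"
      by (simp add: algebra_simps power2_eq_square)
    with that show ?thesis by simp
  qed
  have "(\<lambda>z. hquot F z 0) holomorphic_on ball z0 R"
    by (rule holo2_at_0[OF holo2_hquot[OF F] R])
  then have "F1 holomorphic_on ball z0 R" by (simp add: F1_def[abs_def] hquot_0)
  then have cont: "isCont F1 z"
    using z by (auto simp: continuous_on_eq_continuous_at dest!: holomorphic_on_imp_continuous_on)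
  have "((\<lambda>h. h * (K z h - K (z + h) (- h))) \<longlongrightarrow> 0) (at 0)"
  proof (rule Lim_null_comparison)
    have "\<forall>\<^sub>F h in at 0. norm (h::complex) < \<rho>"
      using \<rho>(1) by (auto simp: eventually_at dist_norm)
    then show "\<forall>\<^sub>F h in at 0. norm (h * (K z h - K (z + h) (- h))) \<le> 2 * M * norm h"
    proof eventually_elim
      case (elim h)
      have "norm (K z h - K (z + h) (- h)) \<le> M + M"
        using elim \<rho>(1) dist_triangle[of z0 "z + h" z]
        by (intro order.trans[OF norm_triangle_ineq4] add_mono M) (auto simp: dist_norm)
      then show ?case
        using mult_left_mono[of _ "M + M" "norm h"] by (fastforce simp: norm_mult mult_ac)
    qed
    show "((\<lambda>h::complex. 2 * M * norm h) \<longlongrightarrow> 0) (at 0)"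
      by (auto intro!: tendsto_eq_intros)
  qed
  then have "((\<lambda>h. F1 z + F1 (z + h) + h * (K z h - K (z + h) (- h))) \<longlongrightarrow> F1 z + F1 z + 0) (at 0)"
    using cont by (intro tendsto_intros) (simp_all add: isCont_iff)
  then have "((\<lambda>h. F1 z + F1 (z + h) + h * (K z h - K (z + h) (- h))) \<longlongrightarrow> 2 * deriv (F z) 0) (at 0)"
    by (simp add: F1_def)
  then show "((\<lambda>z. F z 0) has_field_derivative 2 * deriv (F z) 0) (at z)"
    unfolding DERIV_def
    by (rule Lim_transform_eventually)
       (auto simp: eventually_at_filter eq F1_def)
qed

section \<open>The equation with linear potential\<close>

text \<open>Taylor coefficients at \<open>s = 0\<close> of the solution of \<open>y'' = (x + h s) y\<close> with \<open>y 0 = \<alpha>\<close> and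
\<open>y' 0 = \<beta>\<close>. They are polynomials in \<open>x\<close> and \<open>h\<close>, hence regular at \<open>h = 0\<close>, where the
rescaling of the Airy functions is singular.\<close>

fun lin_coeff :: "complex \<Rightarrow> complex \<Rightarrow> complex \<Rightarrow> complex \<Rightarrow> nat \<Rightarrow> complex" where
  "lin_coeff \<alpha> \<beta> x h 0 = \<alpha>"
| "lin_coeff \<alpha> \<beta> x h (Suc 0) = \<beta>"
| "lin_coeff \<alpha> \<beta> x h (Suc (Suc 0)) = x * \<alpha> / 2"
| "lin_coeff \<alpha> \<beta> x h (Suc (Suc (Suc n))) =
     (x * lin_coeff \<alpha> \<beta> x h (Suc n) + h * lin_coeff \<alpha> \<beta> x h n) / (of_nat (n + 2) * of_nat (n + 3))"

lemma root3_fact_Suc: "root 3 (fact (Suc n)) = root 3 (real (Suc n)) * root 3 (fact n)"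
  unfolding fact_Suc by (simp add: real_root_mult)

lemma root3_fact_ge_1: "root 3 (fact n) \<ge> 1"
  by (simp add: fact_ge_1)

lemma summable_power_div_root3_fact:
  assumes "J \<ge> 0"
  shows "summable (\<lambda>n. J ^ n / root 3 (fact n))"
proof (rule summable_ratio_test[of "1/2" "nat \<lceil>(2 * J) ^ 3\<rceil>"])
  fix n assume "nat \<lceil>(2 * J) ^ 3\<rceil> \<le> n"
  then have "(2 * J) ^ 3 \<le> real (Suc n)" by linarith
  then have "root 3 ((2 * J) ^ 3) \<le> root 3 (real (Suc n))" by (rule real_root_le_mono[rotated]) simp
  then have *: "2 * J \<le> root 3 (real (Suc n))"
    using assms by (subst (asm) real_root_power_cancel) auto
  have pos: "root 3 (real (Suc n)) > 0" "root 3 (fact n) > 0" by simp_all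
  have "J / root 3 (real (Suc n)) \<le> 1 / 2" using * pos(1) by (simp add: field_simps)
  then have "J / root 3 (real (Suc n)) * (J ^ n / root 3 (fact n)) \<le> 1 / 2 * (J ^ n / root 3 (fact n))"
    using pos assms by (intro mult_right_mono) auto
  moreover have "J ^ Suc n / root 3 (fact (Suc n)) = J / root 3 (real (Suc n)) * (J ^ n / root 3 (fact n))"
    unfolding root3_fact_Suc by simp
  moreover have "J ^ Suc n / root 3 (fact (Suc n)) \<ge> 0" "J ^ n / root 3 (fact n) \<ge> 0"
    using assms by simp_all
  ultimately show "norm (J ^ Suc n / root 3 (fact (Suc n))) \<le> 1/2 * norm (J ^ n / root 3 (fact n))"
    unfolding real_norm_def by (simp only: abs_of_nonneg)
qed simp

text \<open>The recursion divides by \<open>(n + 2) * (n + 3)\<close>, whereas the cube root of the factorial grows only by a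
factor of at most \<open>n + 3\<close> from \<open>n\<close> to \<open>n + 3\<close>. A power of the factorial in the
denominator makes the series converge for all \<open>s\<close>.\<close>

lemma norm_lin_coeff_le:
  assumes "norm x + norm h \<le> K" "K \<ge> 1"
  shows "norm (lin_coeff \<alpha> \<beta> x h n) \<le> (norm \<alpha> + norm \<beta>) * K ^ n / root 3 (fact n)"
proof (induction \<alpha> \<beta> x\<equiv>x h\<equiv>h n rule: lin_coeff.induct)
  case (2 \<alpha> \<beta>)
  have "norm \<beta> * 1 \<le> (norm \<alpha> + norm \<beta>) * K" using assms by (intro mult_mono) auto
  then show ?case by simp
next
  case (3 \<alpha> \<beta>)
  have "norm x \<le> K" using assms(1) norm_ge_zero[of h] by linarith
  then have "norm x * norm \<alpha> \<le> K * (norm \<alpha> + norm \<beta>)"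
    using assms(2) by (intro mult_mono) auto
  also have "\<dots> \<le> K * K * (norm \<alpha> + norm \<beta>)"
    using assms by (intro mult_right_mono) auto
  finally have "norm x * norm \<alpha> / 2 \<le> K * K * (norm \<alpha> + norm \<beta>) / 2" by simp
  also have "\<dots> \<le> K * K * (norm \<alpha> + norm \<beta>) / root 3 2"
  proof (rule divide_left_mono)
    have "root 3 2 \<le> root 3 ((2::real) ^ 3)" by (rule real_root_le_mono) auto
    then show "root 3 (2::real) \<le> 2" by (simp add: real_root_power_cancel del: real_root_le_iff)
  qed (use assms in auto)
  finally show ?case
    by (simp add: norm_mult norm_divide power2_eq_square mult_ac numeral_2_eq_2 fact_numeral)
next
  case (4 \<alpha> \<beta> n)
  let ?M = "norm \<alpha> + norm \<beta>" and ?r = "\<lambda>n. root 3 (fact n) :: real"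
  have r: "?r n \<ge> 1" for n by (rule root3_fact_ge_1)
  have r1: "?r (Suc n) \<ge> ?r n" by (rule real_root_le_mono) (auto intro: fact_mono)
  have KK: "K ^ n \<le> K ^ Suc n" by (rule power_increasing[OF _ assms(2)]) simp
  have KK3: "K ^ (n + 2) \<le> K ^ (n + 3)" by (rule power_increasing[OF _ assms(2)]) simp
  have a: "norm (lin_coeff \<alpha> \<beta> x h (Suc n)) \<le> ?M * K ^ Suc n / ?r n"
    using assms(2) r[of n] r1
    by (intro order.trans[OF 4(1)] divide_left_mono mult_nonneg_nonneg mult_pos_pos) auto
  have "?M * K ^ n \<le> ?M * K ^ Suc n" by (rule mult_left_mono[OF KK]) auto
  then have b: "norm (lin_coeff \<alpha> \<beta> x h n) \<le> ?M * K ^ Suc n / ?r n"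
    using r[of n] by (intro order.trans[OF 4(2)] divide_right_mono) auto
  have "norm (x * lin_coeff \<alpha> \<beta> x h (Suc n) + h * lin_coeff \<alpha> \<beta> x h n)
          \<le> norm x * (?M * K ^ Suc n / ?r n) + norm h * (?M * K ^ Suc n / ?r n)"
    using mult_left_mono[OF a norm_ge_zero[of x]] mult_left_mono[OF b norm_ge_zero[of h]]
    by (intro order.trans[OF norm_triangle_ineq] add_mono) (simp_all only: norm_mult)
  also have "\<dots> = (norm x + norm h) * (?M * K ^ Suc n / ?r n)" by (rule distrib_right[symmetric])
  also have "\<dots> \<le> K * (?M * K ^ Suc n / ?r n)"
    using assms r[of n] by (intro mult_right_mono) auto
  also have "\<dots> = ?M * K ^ (n + 2) / ?r n" by simp
  also have "\<dots> \<le> ?M * K ^ (n + 3) / ?r n"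
    using r[of n] by (intro divide_right_mono mult_left_mono[OF KK3]) auto
  finally have num: "norm (x * lin_coeff \<alpha> \<beta> x h (Suc n) + h * lin_coeff \<alpha> \<beta> x h n)
                       \<le> ?M * K ^ (n + 3) / ?r n" .
  have "?r (n + 3) = root 3 (real (n + 1) * real (n + 2) * real (n + 3)) * ?r n"
    using root3_fact_Suc[of "Suc (Suc n)"] root3_fact_Suc[of "Suc n"] root3_fact_Suc[of n]
    by (simp add: real_root_mult eval_nat_numeral mult_ac)
  also have "root 3 (real (n + 1) * real (n + 2) * real (n + 3)) \<le> root 3 (real (n + 3) ^ 3)"
    unfolding power3_eq_cube by (intro real_root_le_mono mult_mono) auto
  also have "root 3 (real (n + 3) ^ 3) = real (n + 3)" by (simp add: real_root_power_cancel)
  also have "\<dots> \<le> real (n + 2) * real (n + 3)" by simp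
  finally have den: "?r (n + 3) \<le> real (n + 2) * real (n + 3) * ?r n"
    using r[of n] by (simp add: mult_right_mono)
  have "norm (lin_coeff \<alpha> \<beta> x h (Suc (Suc (Suc n))))
          = norm (x * lin_coeff \<alpha> \<beta> x h (Suc n) + h * lin_coeff \<alpha> \<beta> x h n) / (real (n + 2) * real (n + 3))"
    unfolding lin_coeff.simps norm_divide norm_mult norm_of_nat by simp
  also have "\<dots> \<le> ?M * K ^ (n + 3) / ?r n / (real (n + 2) * real (n + 3))"
    by (rule divide_right_mono[OF num]) simp
  also have "\<dots> = ?M * K ^ (n + 3) / (real (n + 2) * real (n + 3) * ?r n)" by simp
  also have "\<dots> \<le> ?M * K ^ (n + 3) / ?r (n + 3)"
    using assms(2) r[of n] r[of "n + 3"] by (intro divide_left_mono den) auto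
  finally show ?case by (simp add: eval_nat_numeral)
qed simp_all

text \<open>One majorant for the series and for its term-by-term derivative, uniform in the parameters.\<close>

lemma lin_coeff_majorant:
  assumes "norm x + norm h \<le> K" "norm s \<le> K" "K \<ge> 1"
  shows "norm (lin_coeff \<alpha> \<beta> x h n * s ^ n)
           \<le> (norm \<alpha> + norm \<beta>) * (2 * K) * ((2 * K * K) ^ n / root 3 (fact n))"
    and "norm (diffs (lin_coeff \<alpha> \<beta> x h) n * s ^ n)
           \<le> (norm \<alpha> + norm \<beta>) * (2 * K) * ((2 * K * K) ^ n / root 3 (fact n))"
proof -
  let ?M = "norm \<alpha> + norm \<beta>" and ?r = "\<lambda>n. root 3 (fact n) :: real"
  have r: "?r n \<ge> 1" for n by (rule root3_fact_ge_1)
  have sn: "norm (s ^ n) \<le> K ^ n"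
    unfolding norm_power by (intro power_mono assms) auto
  have "norm (lin_coeff \<alpha> \<beta> x h n * s ^ n) \<le> (?M * K ^ n / ?r n) * K ^ n"
    unfolding norm_mult using assms r[of n]
    by (intro mult_mono norm_lin_coeff_le sn) auto
  also have "\<dots> = ?M * 1 * ((K * K) ^ n / ?r n)" by (simp add: power_mult_distrib)
  also have "\<dots> \<le> ?M * (2 * K) * ((2 * K * K) ^ n / ?r n)"
    using assms r[of n] by (intro mult_mono divide_right_mono power_mono) auto
  finally show "norm (lin_coeff \<alpha> \<beta> x h n * s ^ n) \<le> ?M * (2 * K) * ((2 * K * K) ^ n / ?r n)" .
  have r1: "?r (Suc n) \<ge> ?r n" by (rule real_root_le_mono) (auto intro: fact_mono)
  have two: "real (Suc n) \<le> 2 ^ Suc n"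
    using less_exp[of "Suc n"] by (metis less_imp_le of_nat_le_iff of_nat_numeral of_nat_power)
  have "norm (diffs (lin_coeff \<alpha> \<beta> x h) n * s ^ n)
          = real (Suc n) * norm (lin_coeff \<alpha> \<beta> x h (Suc n)) * norm (s ^ n)"
    unfolding diffs_def norm_mult norm_of_nat by simp
  also have "\<dots> \<le> 2 ^ Suc n * (?M * K ^ Suc n / ?r (Suc n)) * K ^ n"
    using assms r[of "Suc n"] by (intro mult_mono norm_lin_coeff_le sn two) auto
  also have "\<dots> \<le> 2 ^ Suc n * (?M * K ^ Suc n / ?r n) * K ^ n"
    using assms r[of "Suc n"] r[of n]
    by (intro mult_right_mono mult_left_mono divide_left_mono r1) auto
  also have "\<dots> = ?M * (2 * K) * ((2 * K * K) ^ n / ?r n)" by (simp add: power_mult_distrib)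
  finally show "norm (diffs (lin_coeff \<alpha> \<beta> x h) n * s ^ n)
                  \<le> ?M * (2 * K) * ((2 * K * K) ^ n / ?r n)" .
qed

definition lin_sol :: "complex \<Rightarrow> complex \<Rightarrow> complex \<Rightarrow> complex \<Rightarrow> complex \<Rightarrow> complex" where
  "lin_sol \<alpha> \<beta> x h s = (\<Sum>n. lin_coeff \<alpha> \<beta> x h n * s ^ n)"

definition lin_sol' :: "complex \<Rightarrow> complex \<Rightarrow> complex \<Rightarrow> complex \<Rightarrow> complex \<Rightarrow> complex" where
  "lin_sol' \<alpha> \<beta> x h s = (\<Sum>n. diffs (lin_coeff \<alpha> \<beta> x h) n * s ^ n)"

lemma summable_lin_coeff: "summable (\<lambda>n. lin_coeff \<alpha> \<beta> x h n * s ^ n)"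
  and summable_diffs_lin_coeff: "summable (\<lambda>n. diffs (lin_coeff \<alpha> \<beta> x h) n * s ^ n)"
proof -
  define K where "K = norm x + norm h + norm s + 1"
  have K: "norm x + norm h \<le> K" "norm s \<le> K" "K \<ge> 1" by (auto simp: K_def)
  have sm: "summable (\<lambda>n. (norm \<alpha> + norm \<beta>) * (2 * K) * ((2 * K * K) ^ n / root 3 (fact n)))"
    using K by (intro summable_mult summable_power_div_root3_fact) auto
  show "summable (\<lambda>n. lin_coeff \<alpha> \<beta> x h n * s ^ n)"
    by (rule summable_comparison_test'[OF sm lin_coeff_majorant(1)[OF K]])
  show "summable (\<lambda>n. diffs (lin_coeff \<alpha> \<beta> x h) n * s ^ n)"
    by (rule summable_comparison_test'[OF sm lin_coeff_majorant(2)[OF K]])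
qed

lemma lin_sol_0 [simp]: "lin_sol \<alpha> \<beta> x h 0 = \<alpha>" "lin_sol' \<alpha> \<beta> x h 0 = \<beta>"
  unfolding lin_sol_def lin_sol'_def by (simp_all add: diffs_def)

text \<open>The function and its derivative are carried as a pair, so that initial values and the Wronskian
need no \<open>deriv\<close>.\<close>

definition solves_lin :: "complex \<Rightarrow> complex \<Rightarrow> (complex \<Rightarrow> complex) \<Rightarrow> (complex \<Rightarrow> complex) \<Rightarrow> bool" where
  "solves_lin x h f f' \<longleftrightarrow>
     (\<forall>s. (f has_field_derivative f' s) (at s)) \<and>
     (\<forall>s. (f' has_field_derivative (x + h * s) * f s) (at s))"

lemma solves_linI:
  assumes "\<And>s. (f has_field_derivative f' s) (at s)"
    and "\<And>s. (f' has_field_derivative (x + h * s) * f s) (at s)"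
  shows "solves_lin x h f f'"
  using assms by (simp add: solves_lin_def)

lemma solves_linD:
  assumes "solves_lin x h f f'"
  shows "(f has_field_derivative f' s) (at s)"
    and "(f' has_field_derivative (x + h * s) * f s) (at s)"
  using assms by (simp_all add: solves_lin_def)

lemma solves_lin_lin_sol: "solves_lin x h (lin_sol \<alpha> \<beta> x h) (lin_sol' \<alpha> \<beta> x h)"
proof (rule solves_linI)
  fix s
  show "(lin_sol \<alpha> \<beta> x h has_field_derivative lin_sol' \<alpha> \<beta> x h s) (at s)"
    unfolding lin_sol_def lin_sol'_def
    by (rule termdiffs_strong_converges_everywhere[OF summable_lin_coeff])
  let ?c = "lin_coeff \<alpha> \<beta> x h"
  have co: "diffs (diffs ?c) n = x * ?c n + (case n of 0 \<Rightarrow> 0 | Suc m \<Rightarrow> h * ?c m)" for n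
  proof (cases n)
    case (Suc m)
    have "of_nat (m + 2) * of_nat (m + 3) \<noteq> (0 :: complex)"
      unfolding of_nat_mult[symmetric] of_nat_eq_0_iff by simp
    moreover have "diffs (diffs ?c) n = (of_nat (m + 2) * of_nat (m + 3)) * ?c (Suc (Suc (Suc m)))"
      unfolding diffs_def Suc by (simp add: mult_ac numeral_eq_Suc)
    ultimately show ?thesis unfolding lin_coeff.simps by (simp add: Suc)
  qed (simp add: diffs_def)
  have s1: "(\<lambda>n. x * (?c n * s ^ n)) sums (x * lin_sol \<alpha> \<beta> x h s)"
    unfolding lin_sol_def by (intro sums_mult summable_sums summable_lin_coeff)
  have "(\<lambda>n. (h * s) * (?c n * s ^ n)) sums (h * s * lin_sol \<alpha> \<beta> x h s)"
    unfolding lin_sol_def by (intro sums_mult summable_sums summable_lin_coeff)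
  then have s2: "(\<lambda>n. (case n of 0 \<Rightarrow> 0 | Suc m \<Rightarrow> h * ?c m) * s ^ n) sums (h * s * lin_sol \<alpha> \<beta> x h s)"
    using sums_Suc[of "\<lambda>n. (case n of 0 \<Rightarrow> 0 | Suc m \<Rightarrow> h * ?c m) * s ^ n"] by (simp add: mult_ac)
  have "(\<lambda>n. diffs (diffs ?c) n * s ^ n) sums ((x + h * s) * lin_sol \<alpha> \<beta> x h s)"
    using sums_add[OF s1 s2] by (simp add: co algebra_simps)
  then have "(\<Sum>n. diffs (diffs ?c) n * s ^ n) = (x + h * s) * lin_sol \<alpha> \<beta> x h s"
    by (rule sums_unique[symmetric])
  then show "(lin_sol' \<alpha> \<beta> x h has_field_derivative (x + h * s) * lin_sol \<alpha> \<beta> x h s) (at s)"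
    using termdiffs_strong_converges_everywhere[OF summable_diffs_lin_coeff]
    unfolding lin_sol'_def by metis
qed

text \<open>There is no first-order term in the equation. Uniqueness for given initial values and the
reversal symmetry are both read off from this one conservation law.\<close>

lemma wronskian_constant:
  assumes f: "solves_lin x h f f'" and g: "solves_lin x h g g'"
  shows "f s * g' s - f' s * g s = f 0 * g' 0 - f' 0 * g 0"
proof -
  have "\<exists>c. \<forall>s\<in>UNIV. f s * g' s - f' s * g s = c"
  proof (rule has_field_derivative_zero_constant)
    fix s
    show "((\<lambda>s. f s * g' s - f' s * g s) has_field_derivative 0) (at s within UNIV)"
      by (rule derivative_eq_intros solves_linD[OF f] solves_linD[OF g] refl)+
         (simp add: algebra_simps)
  qed auto
  then show ?thesis by auto
qed

lemma solves_lin_unique: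
  assumes f: "solves_lin x h f f'"
  shows "f s = lin_sol 1 0 x h s * f 0 + lin_sol 0 1 x h s * f' 0"
    and "f' s = lin_sol' 1 0 x h s * f 0 + lin_sol' 0 1 x h s * f' 0"
proof -
  note P = solves_lin_lin_sol[of x h 1 0] and Q = solves_lin_lin_sol[of x h 0 1]
  have "lin_sol 1 0 x h s * lin_sol' 0 1 x h s - lin_sol' 1 0 x h s * lin_sol 0 1 x h s = 1"
    "f s * lin_sol' 0 1 x h s - f' s * lin_sol 0 1 x h s = f 0"
    "f s * lin_sol' 1 0 x h s - f' s * lin_sol 1 0 x h s = - f' 0"
    using wronskian_constant[OF P Q, of s] wronskian_constant[OF f Q, of s]
      wronskian_constant[OF f P, of s] by simp_all
  then show "f s = lin_sol 1 0 x h s * f 0 + lin_sol 0 1 x h s * f' 0"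
    and "f' s = lin_sol' 1 0 x h s * f 0 + lin_sol' 0 1 x h s * f' 0"
    by algebra+
qed

text \<open>If \<open>f\<close> solves the equation of the step from \<open>x\<close> to \<open>x + h s\<close>, then \<open>f (s - t)\<close>, as a function of \<open>t\<close>,
solves the equation of the step back. For each of the two identities, take for \<open>f\<close> the solution that the
right side refers to and compare, for \<open>f (s - t)\<close> and the solution on the left, the Wronskian at \<open>t = 0\<close> and at \<open>t = s\<close>.\<close>

lemma lin_sol_reverse:
  "lin_sol 0 1 (x + h * s) (- h) s = lin_sol 0 1 x h s"
  "lin_sol' 1 0 (x + h * s) (- h) s = lin_sol' 1 0 x h s"
proof -
  have rev: "solves_lin (x + h * s) (- h) (\<lambda>t. f (s - t)) (\<lambda>t. - f' (s - t))"
    if f: "solves_lin x h f f'" for f f'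
  proof (rule solves_linI)
    fix t
    have inner: "((\<lambda>t. s - t) has_field_derivative -1) (at t)"
      by (auto intro!: derivative_eq_intros)
    show "((\<lambda>t. f (s - t)) has_field_derivative - f' (s - t)) (at t)"
      using DERIV_chain2[OF solves_linD(1)[OF f] inner] by simp
    show "((\<lambda>t. - f' (s - t)) has_field_derivative (x + h * s + - h * t) * f (s - t)) (at t)"
      using DERIV_minus[OF DERIV_chain2[OF solves_linD(2)[OF f] inner]] by (simp add: algebra_simps)
  qed
  show "lin_sol 0 1 (x + h * s) (- h) s = lin_sol 0 1 x h s"
    using wronskian_constant[OF rev[OF solves_lin_lin_sol[of x h 0 1]] solves_lin_lin_sol[of _ _ 0 1], of s]
    by simp
  show "lin_sol' 1 0 (x + h * s) (- h) s = lin_sol' 1 0 x h s"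
    using wronskian_constant[OF rev[OF solves_lin_lin_sol[of x h 1 0]] solves_lin_lin_sol[of _ _ 1 0], of s]
    by simp
qed

text \<open>For \<open>h = 0\<close> the coefficient is constant, so the derivative of a solution is again a solution;
its initial values identify it.\<close>

lemma lin_sol_h0:
  "lin_sol' 0 1 x 0 s = lin_sol 1 0 x 0 s"
  "lin_sol' 1 0 x 0 s = x * lin_sol 0 1 x 0 s"
proof -
  have d: "solves_lin x 0 f' (\<lambda>s. x * f s)" if "solves_lin x 0 f f'" for f f'
    using solves_linD[OF that] by (intro solves_linI) (auto intro!: derivative_eq_intros)
  show "lin_sol' 0 1 x 0 s = lin_sol 1 0 x 0 s" "lin_sol' 1 0 x 0 s = x * lin_sol 0 1 x 0 s"
    using solves_lin_unique(1)[OF d[OF solves_lin_lin_sol[of x 0 0 1]], of s]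
      solves_lin_unique(1)[OF d[OF solves_lin_lin_sol[of x 0 1 0]], of s] by simp_all
qed

lemma lin_sol_10_h0:
  assumes "q\<^sup>2 = x"
  shows "lin_sol 1 0 x 0 s = cosh (q * s)"
proof -
  have "solves_lin x 0 (\<lambda>s. cosh (q * s)) (\<lambda>s. q * sinh (q * s))"
    by (rule solves_linI)
       (auto intro!: derivative_eq_intros simp: power2_eq_square simp flip: assms)
  from solves_lin_unique(1)[OF this, of s] show ?thesis by simp
qed

lemma g_fun_eq_lin_sol: "g_fun \<zeta> z = lin_sol 0 1 (\<zeta> z) 0 (deriv \<zeta> z)"
proof (cases "\<zeta> z = 0")
  case True
  have "solves_lin 0 0 (\<lambda>s. s) (\<lambda>s. 1)"
    by (rule solves_linI) (auto intro!: derivative_eq_intros)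
  from solves_lin_unique(1)[OF this, of "deriv \<zeta> z"] True show ?thesis
    by (simp add: g_fun_def)
next
  case False
  define q where "q = csqrt (\<zeta> z)"
  have q: "q\<^sup>2 = \<zeta> z" "q \<noteq> 0" using False by (auto simp: q_def)
  have "solves_lin (\<zeta> z) 0 (\<lambda>s. sinh (q * s) / q) (\<lambda>s. cosh (q * s))"
    by (rule solves_linI)
       (use q(2) in \<open>auto intro!: derivative_eq_intros simp: power2_eq_square simp flip: q(1)\<close>)
  from solves_lin_unique(1)[OF this, of "deriv \<zeta> z"] False q(2) show ?thesis
    by (simp add: g_fun_def flip: q_def)
qed

section \<open>Airy functions\<close>

lemma lin_coeff_add3:
  "lin_coeff \<alpha> \<beta> 0 1 (n + 3) = lin_coeff \<alpha> \<beta> 0 1 n / (of_nat (n + 2) * of_nat (n + 3))"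
  by (simp add: numeral_eq_Suc)

lemma lin_coeff_airy:
  "lin_coeff \<alpha> \<beta> 0 1 (3 * k) = \<alpha> * (3 ^ k * pochhammer (1/3) k / fact (3 * k))"
  "lin_coeff \<alpha> \<beta> 0 1 (3 * k + 1) = \<beta> * (3 ^ k * pochhammer (2/3) k / fact (3 * k + 1))"
  "lin_coeff \<alpha> \<beta> 0 1 (3 * k + 2) = 0"
proof (induction k)
  case (Suc k)
  have ne: "(of_nat (m + 1) :: complex) \<noteq> 0" for m unfolding of_nat_eq_0_iff by simp
  have ratio: "\<alpha> * (N / F) / (c2 * c3) = \<alpha> * (c1 * N / (c3 * c2 * c1 * F))" if "c1 \<noteq> 0"
    for \<alpha> N F c1 c2 c3 :: complex
    using that by (simp add: divide_simps)
  have e: "3 * Suc k = 3 * k + 3" "3 * Suc k + 1 = (3 * k + 1) + 3" by simp_all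
  {
    case 1
    have f: "fact (3 * k + 3) = (of_nat (3 * k + 3) * of_nat (3 * k + 2) * of_nat (3 * k + 1)) * (fact (3 * k) :: complex)"
      by (simp add: numeral_eq_Suc algebra_simps)
    have p: "3 ^ Suc k * pochhammer (1/3) (Suc k) = of_nat (3 * k + 1) * (3 ^ k * pochhammer (1/3) k :: complex)"
      by (simp add: pochhammer_Suc algebra_simps)
    show ?case
      unfolding e(1) lin_coeff_add3 Suc(1) f p by (rule ratio[OF ne])
  next
    case 2
    have f: "fact (3 * k + 1 + 3) = (of_nat (3 * k + 1 + 3) * of_nat (3 * k + 1 + 2) * of_nat (3 * k + 1 + 1)) * (fact (3 * k + 1) :: complex)"
      by (simp add: numeral_eq_Suc algebra_simps)
    have p: "3 ^ Suc k * pochhammer (2/3) (Suc k) = of_nat (3 * k + 1 + 1) * (3 ^ k * pochhammer (2/3) k :: complex)"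
      by (simp add: pochhammer_Suc algebra_simps)
    show ?case
      unfolding e(2) lin_coeff_add3 Suc(2) f p by (rule ratio[OF ne])
  next
    case 3
    show ?case
      using lin_coeff_add3[of \<alpha> \<beta> "3 * k + 2"] Suc(3) by (simp add: algebra_simps)
  }
qed (simp_all add: numeral_2_eq_2)

text \<open>The two series that define the Airy function are the fundamental solutions of \<open>y'' = s y\<close>, with the
vanishing coefficients left out.\<close>

lemma airy_series:
  "(\<Sum>k. 3 ^ k * pochhammer (1/3) k / fact (3 * k) * z ^ (3 * k)) = lin_sol 1 0 0 1 z"
  "(\<Sum>k. 3 ^ k * pochhammer (2/3) k / fact (3 * k + 1) * z ^ (3 * k + 1)) = lin_sol 0 1 0 1 z"
proof -
  have mod3: "n = 3 * (n div 3) \<or> n = 3 * (n div 3) + 1 \<or> n = 3 * (n div 3) + 2" for n :: nat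
    by presburger
  have z1: "lin_coeff 1 0 0 1 n * z ^ n = 0" if n: "n \<notin> range (\<lambda>k. 3 * k)" for n
  proof -
    obtain k where "n = 3 * k + 1 \<or> n = 3 * k + 2"
      using mod3[of n] n range_eqI[of n "\<lambda>k. 3 * k" "n div 3"] by blast
    then show ?thesis
      by (elim disjE) (simp_all only: lin_coeff_airy mult_zero_left)
  qed
  have z2: "lin_coeff 0 1 0 1 n * z ^ n = 0" if n: "n \<notin> range (\<lambda>k. 3 * k + 1)" for n
  proof -
    obtain k where "n = 3 * k \<or> n = 3 * k + 2"
      using mod3[of n] n range_eqI[of n "\<lambda>k. 3 * k + 1" "n div 3"] by blast
    then show ?thesis
      by (elim disjE) (simp_all only: lin_coeff_airy mult_zero_left)
  qed
  show "(\<Sum>k. 3 ^ k * pochhammer (1/3) k / fact (3 * k) * z ^ (3 * k)) = lin_sol 1 0 0 1 z"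
    using suminf_mono_reindex[of "\<lambda>k. 3 * k" "\<lambda>n. lin_coeff 1 0 0 1 n * z ^ n"] z1
    by (simp add: lin_coeff_airy lin_sol_def strict_mono_def)
  show "(\<Sum>k. 3 ^ k * pochhammer (2/3) k / fact (3 * k + 1) * z ^ (3 * k + 1)) = lin_sol 0 1 0 1 z"
    using suminf_mono_reindex[of "\<lambda>k. 3 * k + 1" "\<lambda>n. lin_coeff 0 1 0 1 n * z ^ n"] z2
    by (simp only: lin_coeff_airy lin_sol_def strict_mono_def) simp
qed

text \<open>The rotated functions satisfy the same equation because \<open>airy_omega ^ 3 = 1\<close>.\<close>

lemma airy_ode: "solves_lin 0 1 (airy_w j) (deriv (airy_w j))"
proof -
  define c1 c2 :: complex where "c1 = of_real (1 / (3 powr (2/3) * Gamma (2/3 :: real)))"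
    and "c2 = of_real (1 / (3 powr (1/3) * Gamma (1/3 :: real)))"
  define Ai' where "Ai' z = c1 * lin_sol' 1 0 0 1 z - c2 * lin_sol' 0 1 0 1 z" for z
  define w where "w = airy_omega ^ j"
  define w' where "w' x = 2 * of_real pi * \<i> * w ^ 2 * Ai' (w * x)" for x
  have "airy_omega ^ 3 = 1"
    unfolding airy_omega_def exp_of_nat_mult[symmetric] by (simp add: mult_ac)
  then have w3: "w ^ 3 = 1" unfolding w_def by (metis power_mult mult.commute power_one)
  have Ai: "Ai = (\<lambda>z. c1 * lin_sol 1 0 0 1 z - c2 * lin_sol 0 1 0 1 z)"
    unfolding Ai_def airy_series c1_def c2_def by (rule refl)
  note D = solves_linD[OF solves_lin_lin_sol[of 0 1 1 0]] solves_linD[OF solves_lin_lin_sol[of 0 1 0 1]]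
  have Ai1: "(Ai has_field_derivative Ai' x) (at x)" for x
    unfolding Ai Ai'_def by (auto intro!: derivative_eq_intros D)
  have Ai2: "(Ai' has_field_derivative x * Ai x) (at x)" for x
    unfolding Ai Ai'_def by (auto intro!: derivative_eq_intros D simp: algebra_simps)
  have w1: "(airy_w j has_field_derivative w' x) (at x)" for x
    unfolding airy_w_def w'_def w_def[symmetric]
    by (auto intro!: derivative_eq_intros DERIV_chain2[OF Ai1] simp: power2_eq_square)
  have w2: "(w' has_field_derivative x * airy_w j x) (at x)" for x
  proof -
    have "(w' has_field_derivative w ^ 3 * (x * (2 * of_real pi * \<i> * w * Ai (w * x)))) (at x)"
      unfolding w'_def
      by (auto intro!: derivative_eq_intros DERIV_chain2[OF Ai2] simp: power2_eq_square power3_eq_cube)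
    from this[unfolded w3] show ?thesis by (simp add: airy_w_def w_def)
  qed
  have "deriv (airy_w j) = w'" using w1 by (auto intro: DERIV_imp_deriv)
  with w1 w2 show ?thesis by (intro solves_linI) auto
qed

text \<open>Here \<open>k\<close> stands for \<open>h powr (1/3)\<close> and \<open>\<eta>\<close> for \<open>h\<close> or \<open>- h\<close>, hence \<open>\<eta>\<^sup>2 = k ^ 6\<close>. Along the segment
from \<open>x\<close> to \<open>x + \<eta> s\<close> the rescaled Airy function solves the equation with linear potential
\<open>x + \<eta> s\<close>. Its values at the end are thus exact combinations of the values at the beginning, with
coefficients that do not depend on the choice of the Airy function and are regular in \<open>\<eta>\<close>.\<close>

lemma airy_transport:
  assumes w: "solves_lin 0 1 w w'" and "k \<noteq> 0" and "\<eta>\<^sup>2 = k ^ 6"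
  shows "w ((x + \<eta> * s) / k\<^sup>2) =
           lin_sol 1 0 x \<eta> s * w (x / k\<^sup>2) + \<eta> / k\<^sup>2 * lin_sol 0 1 x \<eta> s * w' (x / k\<^sup>2)"
    and "\<eta> / k\<^sup>2 * w' ((x + \<eta> * s) / k\<^sup>2) =
           lin_sol' 1 0 x \<eta> s * w (x / k\<^sup>2) + \<eta> / k\<^sup>2 * lin_sol' 0 1 x \<eta> s * w' (x / k\<^sup>2)"
proof -
  have inner: "((\<lambda>s. (x + \<eta> * s) / k\<^sup>2) has_field_derivative \<eta> / k\<^sup>2) (at s)" for s
    using DERIV_cdivide[OF DERIV_add[OF DERIV_const DERIV_cmult_Id]] by simp
  have "solves_lin x \<eta> (\<lambda>s. w ((x + \<eta> * s) / k\<^sup>2)) (\<lambda>s. \<eta> / k\<^sup>2 * w' ((x + \<eta> * s) / k\<^sup>2))"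
  proof (rule solves_linI)
    fix s
    show "((\<lambda>s. w ((x + \<eta> * s) / k\<^sup>2)) has_field_derivative \<eta> / k\<^sup>2 * w' ((x + \<eta> * s) / k\<^sup>2)) (at s)"
      using DERIV_chain2[OF solves_linD(1)[OF w] inner[of s]] by (simp add: mult.commute)
    have "\<eta> / k\<^sup>2 * ((x + \<eta> * s) / k\<^sup>2 * w ((x + \<eta> * s) / k\<^sup>2) * (\<eta> / k\<^sup>2))
            = (\<eta>\<^sup>2 / k ^ 6) * ((x + \<eta> * s) * w ((x + \<eta> * s) / k\<^sup>2))"
      by (simp add: power2_eq_square eval_nat_numeral mult_ac)
    also have "\<dots> = (x + \<eta> * s) * w ((x + \<eta> * s) / k\<^sup>2)"
      using assms by simp
    finally show "((\<lambda>s. \<eta> / k\<^sup>2 * w' ((x + \<eta> * s) / k\<^sup>2)) has_field_derivative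
                     (x + \<eta> * s) * w ((x + \<eta> * s) / k\<^sup>2)) (at s)"
      using DERIV_cmult[OF DERIV_chain2[OF solves_linD(2)[OF w] inner[of s]], of "\<eta> / k\<^sup>2"] by simp
  qed
  from solves_lin_unique[OF this, of s]
  show "w ((x + \<eta> * s) / k\<^sup>2) =
           lin_sol 1 0 x \<eta> s * w (x / k\<^sup>2) + \<eta> / k\<^sup>2 * lin_sol 0 1 x \<eta> s * w' (x / k\<^sup>2)"
    and "\<eta> / k\<^sup>2 * w' ((x + \<eta> * s) / k\<^sup>2) =
           lin_sol' 1 0 x \<eta> s * w (x / k\<^sup>2) + \<eta> / k\<^sup>2 * lin_sol' 0 1 x \<eta> s * w' (x / k\<^sup>2)"
    by (simp_all add: mult_ac)
qed

lemma holo2_lin_coeff: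
  assumes "holo2 z0 R X"
  shows "holo2 z0 R (\<lambda>z h. lin_coeff \<alpha> \<beta> (X z h) h n)"
proof (induction n rule: less_induct)
  case (less n)
  consider "n = 0" | "n = Suc 0" | "n = Suc (Suc 0)" | m where "n = Suc (Suc (Suc m))"
    using not0_implies_Suc by (metis (no_types))
  then show ?case
  proof cases
    case 1
    show ?thesis unfolding 1 lin_coeff.simps by (rule holo2_const)
  next
    case 2
    show ?thesis unfolding 2 lin_coeff.simps by (rule holo2_const)
  next
    case 3
    show ?thesis unfolding 3 lin_coeff.simps divide_inverse
      by (intro holo2_intros assms)
  next
    case (4 m)
    show ?thesis unfolding 4 lin_coeff.simps divide_inverse
      by (intro holo2_intros assms less) (auto simp: 4)
  qed
qed

lemma holo2_lin_sol:
  assumes X: "holo2 z0 R X" and S: "holo2 z0 R S"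
  shows "holo2 z0 R (\<lambda>z h. lin_sol \<alpha> \<beta> (X z h) h (S z h))"
    and "holo2 z0 R (\<lambda>z h. lin_sol' \<alpha> \<beta> (X z h) h (S z h))"
proof -
  have bnd: "\<exists>K. \<forall>z\<in>cball z0 r. \<forall>h\<in>cball 0 \<rho>. norm (X z h) + norm h \<le> K \<and> norm (S z h) \<le> K \<and> K \<ge> 1"
    if rho: "r + \<rho> < R" for r \<rho>
  proof -
    obtain M where M: "M > 0" "\<And>z h. z \<in> cball z0 r \<Longrightarrow> h \<in> cball 0 \<rho> \<Longrightarrow> norm (X z h) \<le> M"
      using holo2_bound[OF X rho] by metis
    obtain N where N: "N > 0" "\<And>z h. z \<in> cball z0 r \<Longrightarrow> h \<in> cball 0 \<rho> \<Longrightarrow> norm (S z h) \<le> N"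
      using holo2_bound[OF S rho] by metis
    show ?thesis
      by (rule exI[of _ "M + N + \<bar>\<rho>\<bar> + 1"]) (use M N in \<open>force\<close>)
  qed
  have maj: "\<exists>M. summable M \<and> (\<forall>n. \<forall>z\<in>cball z0 r. \<forall>h\<in>cball 0 \<rho>.
      norm (lin_coeff \<alpha> \<beta> (X z h) h n * S z h ^ n) \<le> M n \<and>
      norm (diffs (lin_coeff \<alpha> \<beta> (X z h) h) n * S z h ^ n) \<le> M n)" if rho: "r + \<rho> < R" for r \<rho>
  proof -
    obtain K where K: "\<forall>z\<in>cball z0 r. \<forall>h\<in>cball 0 \<rho>. norm (X z h) + norm h \<le> K \<and> norm (S z h) \<le> K \<and> K \<ge> 1"
      using bnd[OF rho] by blast
    let ?M = "\<lambda>n. (norm \<alpha> + norm \<beta>) * (2 * K) * ((2 * K * K) ^ n / root 3 (fact n))"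
    have "summable ?M" 
      by (intro summable_mult summable_power_div_root3_fact) (simp add: mult.assoc)
    then show ?thesis
      by (intro exI[of _ ?M]) (use K lin_coeff_majorant[of _ _ K] in blast)
  qed
  show "holo2 z0 R (\<lambda>z h. lin_sol \<alpha> \<beta> (X z h) h (S z h))"
    unfolding lin_sol_def
  proof (rule holo2_suminf)
    show "holo2 z0 R (\<lambda>z h. lin_coeff \<alpha> \<beta> (X z h) h n * S z h ^ n)" for n
      by (intro holo2_mult holo2_power holo2_lin_coeff X S)
    fix r \<rho> assume "r + \<rho> < R"
    from maj[OF this] show "\<exists>M. summable M \<and> (\<forall>n. \<forall>z\<in>cball z0 r. \<forall>h\<in>cball 0 \<rho>.
        norm (lin_coeff \<alpha> \<beta> (X z h) h n * S z h ^ n) \<le> M n)" by blast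
  qed
  show "holo2 z0 R (\<lambda>z h. lin_sol' \<alpha> \<beta> (X z h) h (S z h))"
    unfolding lin_sol'_def
  proof (rule holo2_suminf)
    show "holo2 z0 R (\<lambda>z h. diffs (lin_coeff \<alpha> \<beta> (X z h) h) n * S z h ^ n)" for n
      unfolding diffs_def by (intro holo2_mult holo2_const holo2_power holo2_lin_coeff X S)
    fix r \<rho> assume "r + \<rho> < R"
    from maj[OF this] show "\<exists>M. summable M \<and> (\<forall>n. \<forall>z\<in>cball z0 r. \<forall>h\<in>cball 0 \<rho>.
        norm (diffs (lin_coeff \<alpha> \<beta> (X z h) h) n * S z h ^ n) \<le> M n)" by blast
  qed
qed

section \<open>Transport equations\<close>

text \<open>Dividing by \<open>q\<close> removes the factor \<open>q\<^sup>2\<close> from the operator \<open>c f' + c' f / 2\<close>. Only the simple models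
\<open>\<phi> = 1\<close> and \<open>\<phi> = z - z0\<close> are then left to solve.\<close>

lemma transport_eq:
  assumes "open S" "z \<in> S" and hol: "\<phi> holomorphic_on S" "q holomorphic_on S" "G holomorphic_on S"
    and nz: "\<And>z. z \<in> S \<Longrightarrow> q z \<noteq> 0" and c: "\<And>z. z \<in> S \<Longrightarrow> c z = \<phi> z * (q z)\<^sup>2"
  shows "c z * deriv (\<lambda>z. G z / q z) z + deriv c z / 2 * (G z / q z)
           = q z * (\<phi> z * deriv G z + deriv \<phi> z / 2 * G z)"
proof -
  note D = holomorphic_derivI[OF hol(1) assms(1,2)] holomorphic_derivI[OF hol(2) assms(1,2)]
    holomorphic_derivI[OF hol(3) assms(1,2)]
  have qz: "q z \<noteq> 0" using nz assms(2) by blast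
  have 1: "deriv (\<lambda>z. G z / q z) z = (deriv G z * q z - G z * deriv q z) / (q z * q z)"
    by (rule DERIV_imp_deriv) (rule DERIV_divide[OF D(3) D(2) qz])
  have "((\<lambda>z. \<phi> z * (q z)\<^sup>2) has_field_derivative
          deriv \<phi> z * (q z)\<^sup>2 + \<phi> z * (2 * q z * deriv q z)) (at z)"
    by (rule derivative_eq_intros D refl)+ (simp add: algebra_simps)
  then have "(c has_field_derivative deriv \<phi> z * (q z)\<^sup>2 + \<phi> z * (2 * q z * deriv q z)) (at z)"
    by (rule has_field_derivative_transform_within_open[OF _ assms(1,2)]) (simp add: c)
  then have 2: "deriv c z = deriv \<phi> z * (q z)\<^sup>2 + \<phi> z * (2 * q z * deriv q z)"
    by (rule DERIV_imp_deriv)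
  show ?thesis unfolding 1 2 c[OF assms(2)] using qz
    by (simp add: field_simps power2_eq_square)
qed

text \<open>On the power \<open>(z - z0) ^ n\<close> the operator \<open>(z - z0) G' + G / 2\<close> is multiplication by \<open>n + 1/2\<close>, which
never vanishes and is at least \<open>1/2\<close>, so that the series of \<open>G\<close> converges where that of \<open>F\<close> does.
Hence, although the equation is singular at \<open>z0\<close>, it has a solution analytic in the whole disk for every right-hand side.\<close>

lemma euler_ode_solution:
  assumes F: "F holomorphic_on ball z0 R"
  obtains G where "G holomorphic_on ball z0 R"
    "\<And>z. z \<in> ball z0 R \<Longrightarrow> (z - z0) * deriv G z + G z / 2 = F z"
proof -
  define f where "f n = (deriv ^^ n) F z0 / fact n" for n
  define g where "g n = f n / (of_nat n + 1/2)" for n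
  define G where "G z = (\<Sum>n. g n * (z - z0) ^ n)" for z
  have f: "(\<lambda>n. f n * (z - z0) ^ n) sums F z" if "z \<in> ball z0 R" for z
    unfolding f_def by (rule holomorphic_power_series[OF F that])
  have half: "norm (of_nat n + 1/2 :: complex) \<ge> 1/2" "(of_nat n + 1/2 :: complex) \<noteq> 0" for n
  proof -
    have "Re (of_nat n + 1/2) \<le> norm (of_nat n + 1/2 :: complex)" by (rule complex_Re_le_cmod)
    then show *: "norm (of_nat n + 1/2 :: complex) \<ge> 1/2" by simp
    show "(of_nat n + 1/2 :: complex) \<noteq> 0" using * by auto
  qed
  have sg: "summable (\<lambda>n. g n * y ^ n)" if y: "norm y < R" for y
  proof -
    define t where "t = (norm y + R) / 2"
    have t: "norm y < t" "t < R" "t > 0" using y norm_ge_zero[of y] by (auto simp: t_def field_simps simp del: norm_ge_zero)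
    have "z0 + of_real t \<in> ball z0 R" using t by (simp add: dist_norm)
    from sums_summable[OF f[OF this]] have "summable (\<lambda>n. f n * of_real t ^ n)" by simp
    then have "summable (\<lambda>n. norm (f n * y ^ n))"
      by (rule powser_insidea) (use t in simp)
    then have "summable (\<lambda>n. 2 * norm (f n * y ^ n))" by (rule summable_mult)
    then show ?thesis
    proof (rule summable_comparison_test')
      fix n
      have "norm (f n * y ^ n) * 1 \<le> norm (f n * y ^ n) * (2 * norm (of_nat n + 1/2 :: complex))"
        using half(1)[of n] by (intro mult_left_mono) auto
      then show "norm (g n * y ^ n) \<le> 2 * norm (f n * y ^ n)"
        using half(2)[of n] unfolding g_def norm_mult norm_divide
        by (simp add: pos_divide_le_eq mult_ac del: norm_ge_zero)
    qed
  qed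
  have G': "(G has_field_derivative (\<Sum>n. diffs g n * (z - z0) ^ n)) (at z)" if "z \<in> ball z0 R" for z
  proof -
    have "norm (z - z0) < R" using that by (simp add: dist_norm norm_minus_commute)
    from termdiffs_strong'[OF sg this] have "((\<lambda>y. \<Sum>n. g n * y ^ n) has_field_derivative (\<Sum>n. diffs g n * (z - z0) ^ n)) (at (z - z0))" .
    moreover have "((\<lambda>z. z - z0) has_field_derivative 1) (at z)"
      by (auto intro!: derivative_eq_intros)
    ultimately show ?thesis
      unfolding G_def[abs_def] using DERIV_chain2[where g = "\<lambda>z. z - z0"] by fastforce
  qed
  show ?thesis
  proof (rule that)
    show "G holomorphic_on ball z0 R"
      unfolding holomorphic_on_open[OF open_ball] using G' by blast
    fix z assume z: "z \<in> ball z0 R"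
    define y where "y = z - z0"
    have y: "norm y < R" using z by (simp add: y_def dist_norm norm_minus_commute)
    have dG: "deriv G z = (\<Sum>n. diffs g n * y ^ n)"
      unfolding y_def by (rule DERIV_imp_deriv[OF G'[OF z]])
    have "(\<lambda>n. of_nat n * g n * y ^ (n - Suc 0)) sums deriv G z"
      unfolding dG by (rule diffs_equiv[OF termdiff_converges[OF y sg]])
    then have "(\<lambda>n. y * (of_nat n * g n * y ^ (n - Suc 0))) sums (y * deriv G z)"
      by (rule sums_mult)
    moreover have "y * (of_nat n * g n * y ^ (n - Suc 0)) = of_nat n * g n * y ^ n" for n
      by (cases n) auto
    ultimately have "(\<lambda>n. of_nat n * g n * y ^ n) sums (y * deriv G z)" by simp
    moreover have "(\<lambda>n. g n * y ^ n / 2) sums (G z / 2)"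
      unfolding G_def y_def[symmetric] by (intro sums_divide summable_sums sg y)
    ultimately have "(\<lambda>n. of_nat n * g n * y ^ n + g n * y ^ n / 2) sums (y * deriv G z + G z / 2)"
      by (rule sums_add)
    moreover have "of_nat n * g n * y ^ n + g n * y ^ n / 2 = f n * y ^ n" for n
    proof -
      have "of_nat n * g n * y ^ n + g n * y ^ n / 2 = (of_nat n + 1/2) * g n * y ^ n"
        by (simp add: algebra_simps)
      then show ?thesis using half(2)[of n] by (simp add: g_def)
    qed
    ultimately have "(\<lambda>n. f n * y ^ n) sums (y * deriv G z + G z / 2)" by simp
    then show "(z - z0) * deriv G z + G z / 2 = F z"
      using f[OF z] sums_unique2 unfolding y_def by blast
  qed
qed

lemma transport_regular:
  assumes q: "q holomorphic_on ball z0 R" "\<And>z. z \<in> ball z0 R \<Longrightarrow> q z \<noteq> 0"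
    and c: "\<And>z. z \<in> ball z0 R \<Longrightarrow> c z = (q z)\<^sup>2"
    and F: "F holomorphic_on ball z0 R"
  shows "\<exists>f. f holomorphic_on ball z0 R \<and>
    (\<forall>z\<in>ball z0 R. c z * deriv f z + deriv c z / 2 * f z = F z)"
proof -
  have "(\<lambda>z. F z / q z) holomorphic_on ball z0 R"
    by (intro holomorphic_intros F q)
  then obtain G where G: "\<And>z. z \<in> ball z0 R \<Longrightarrow> (G has_field_derivative F z / q z) (at z within ball z0 R)"
    using holomorphic_convex_primitive'[of "ball z0 R" "\<lambda>z. F z / q z"] by auto
  then have holG: "G holomorphic_on ball z0 R" unfolding holomorphic_on_def field_differentiable_def by blast
  have dG: "deriv G z = F z / q z" if "z \<in> ball z0 R" for z
    using G[OF that] that by (simp add: at_within_open[OF that] DERIV_imp_deriv)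
  show ?thesis
  proof (intro exI[of _ "\<lambda>z. G z / q z"] conjI ballI)
    show "(\<lambda>z. G z / q z) holomorphic_on ball z0 R" by (intro holomorphic_intros holG q)
    fix z assume z: "z \<in> ball z0 R"
    show "c z * deriv (\<lambda>z. G z / q z) z + deriv c z / 2 * (G z / q z) = F z"
      using transport_eq[of "ball z0 R" z "\<lambda>_. 1" q G c] z q c holG by (simp add: dG)
  qed
qed

lemma transport_singular:
  assumes q: "q holomorphic_on ball z0 R" "\<And>z. z \<in> ball z0 R \<Longrightarrow> q z \<noteq> 0"
    and c: "\<And>z. z \<in> ball z0 R \<Longrightarrow> c z = (z - z0) * (q z)\<^sup>2"
    and F: "F holomorphic_on ball z0 R"
  shows "\<exists>f. f holomorphic_on ball z0 R \<and>
    (\<forall>z\<in>ball z0 R. c z * deriv f z + deriv c z / 2 * f z = F z)"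
proof -
  have "(\<lambda>z. F z / q z) holomorphic_on ball z0 R"
    by (intro holomorphic_intros F q)
  then obtain G where holG: "G holomorphic_on ball z0 R"
    and G: "\<And>z. z \<in> ball z0 R \<Longrightarrow> (z - z0) * deriv G z + G z / 2 = F z / q z"
    using euler_ode_solution by blast
  show ?thesis
  proof (intro exI[of _ "\<lambda>z. G z / q z"] conjI ballI)
    show "(\<lambda>z. G z / q z) holomorphic_on ball z0 R" by (intro holomorphic_intros holG q)
    fix z assume z: "z \<in> ball z0 R"
    have "(\<lambda>z. z - z0) holomorphic_on ball z0 R" by (intro holomorphic_intros)
    moreover have "deriv (\<lambda>z. z - z0) z = 1"
      by (rule DERIV_imp_deriv) (auto intro!: derivative_eq_intros)
    ultimately show "c z * deriv (\<lambda>z. G z / q z) z + deriv c z / 2 * (G z / q z) = F z"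
      using transport_eq[of "ball z0 R" z "\<lambda>z. z - z0" q G c] z q c holG G[OF z] by simp
  qed
qed

text \<open>The zero of \<open>\<zeta>\<close> at \<open>z0\<close> is simple and the only one, both because \<open>\<zeta>\<close> is injective; the remaining
factor has no zeros in the disk and is a square.\<close>

lemma zero_factor_sqrt:
  assumes \<zeta>: "\<zeta> holomorphic_on ball z0 R" and inj: "inj_on \<zeta> (ball z0 R)" and R: "R > 0"
    and 0: "\<zeta> z0 = 0"
  obtains \<kappa> where "\<kappa> holomorphic_on ball z0 R" "\<And>z. z \<in> ball z0 R \<Longrightarrow> \<kappa> z \<noteq> 0"
    "\<And>z. z \<in> ball z0 R \<Longrightarrow> \<zeta> z = (z - z0) * (\<kappa> z)\<^sup>2"
proof -
  define k where "k z = (if z = z0 then deriv \<zeta> z0 else (\<zeta> z - \<zeta> z0) / (z - z0))" for z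
  have k: "k holomorphic_on ball z0 R"
    using pole_lemma_open[OF \<zeta>, of z0] by (simp add: k_def[abs_def])
  have nz: "k z \<noteq> 0" if "z \<in> ball z0 R" for z
    using holomorphic_injective_imp_regular[OF \<zeta> _ inj, of z0] inj_onD[OF inj, of z z0] that R
    by (auto simp: k_def)
  have "contractible (ball z0 R)" by (intro convex_imp_contractible) auto
  from contractible_imp_holomorphic_sqrt[OF k this nz]
  obtain \<kappa> where \<kappa>: "\<kappa> holomorphic_on ball z0 R" "\<And>z. z \<in> ball z0 R \<Longrightarrow> k z = (\<kappa> z)\<^sup>2" by blast
  show ?thesis
  proof (rule that[OF \<kappa>(1)])
    fix z assume z: "z \<in> ball z0 R"
    show "\<kappa> z \<noteq> 0" using nz[OF z] \<kappa>(2)[OF z] by auto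
    show "\<zeta> z = (z - z0) * (\<kappa> z)\<^sup>2"
      unfolding \<kappa>(2)[OF z, symmetric] by (simp add: k_def 0)
  qed
qed

section \<open>Solution in powers of the step\<close>

text \<open>The contribution of one pair \<open>(A, B)\<close> of amplitudes to one component of the difference equation.
The combination is even in \<open>h\<close> in the amplitude of the same component and odd in \<open>h\<close> in the
other one; the same expression, with the roles exchanged, serves for the component along the
derivative of the Airy function.\<close>

definition coupled :: "(complex \<Rightarrow> complex \<Rightarrow> complex) \<Rightarrow> (complex \<Rightarrow> complex \<Rightarrow> complex) \<Rightarrow>
    (complex \<Rightarrow> complex) \<Rightarrow> (complex \<Rightarrow> complex) \<Rightarrow> (complex \<Rightarrow> complex) \<Rightarrow> complex \<Rightarrow> complex \<Rightarrow> complex" where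
  "coupled a c v A B z h =
     A (z + h) * a z h + A (z - h) * a z (- h) + v z * A z
     + (B (z + h) * c z h - B (z - h) * c z (- h))"

text \<open>By parity the even part starts with \<open>2 * a z 0 + v z\<close>, which vanishes, and continues with \<open>h\<^sup>2\<close>; the
odd part starts with \<open>h\<close>. A pair of amplitudes entering at order \<open>h ^ l\<close> therefore acts first at order
\<open>h ^ (l + 1)\<close>, and each component then sees only the amplitude of the other one.\<close>

lemma coupled_expansion:
  assumes a: "holo2 z0 R a" and c: "holo2 z0 R c"
    and A: "A holomorphic_on ball z0 R" and B: "B holomorphic_on ball z0 R"
    and diag: "\<And>z. z \<in> ball z0 R \<Longrightarrow> 2 * a z 0 + v z = 0"
  obtains G where "holo2 z0 R G"
    "\<And>z h. z \<in> ball z0 R \<Longrightarrow> coupled a c v A B z h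
       = 2 * h * (c z 0 * deriv B z + deriv (c z) 0 * B z) + h\<^sup>2 * G z h"
proof -
  define K where "K z h = A (z + h) * a z h" for z h
  define J where "J z h = B (z + h) * c z h" for z h
  have K: "holo2 z0 R K" and J: "holo2 z0 R J"
    unfolding K_def[abs_def] J_def[abs_def] by (intro holo2_mult holo2_shift A B a c)+
  define K2 where "K2 = hquot (hquot K)"
  define J2 where "J2 = hquot (hquot J)"
  have K2: "holo2 z0 R K2" and J2: "holo2 z0 R J2"
    unfolding K2_def J2_def by (intro holo2_hquot K J)+
  show ?thesis
  proof (rule that)
    show "holo2 z0 R (\<lambda>z h. K2 z h + K2 z (- h) + (J2 z h - J2 z (- h)))"
      by (intro holo2_add holo2_diff K2 J2 holo2_flip)
    fix z h assume z: "z \<in> ball z0 R"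
    have "(J z has_field_derivative deriv B z * c z 0 + deriv (c z) 0 * B z) (at 0)"
    proof -
      have "(B has_field_derivative deriv B z) (at (z + 0))"
        using holomorphic_derivI[OF B _ z] by simp
      then have "((\<lambda>h. B (z + h)) has_field_derivative deriv B z) (at 0)"
        using DERIV_shift[of B "deriv B z" 0 z]
        by (simp add: add.commute)
      from DERIV_mult[OF this holo2_has_field_derivative[OF c z]] show ?thesis
        unfolding J_def[abs_def] by simp
    qed
    then have J1: "deriv (J z) 0 = c z 0 * deriv B z + deriv (c z) 0 * B z"
      by (simp add: DERIV_imp_deriv mult.commute)
    have "coupled a c v A B z h = K z h + K z (- h) + v z * A z + (J z h - J z (- h))"
      by (simp add: coupled_def K_def J_def)
    also have "K z h + K z (- h) = 2 * K z 0 + h\<^sup>2 * (K2 z h + K2 z (- h))"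
      using taylor2_eq[of K z h] taylor2_eq[of K z "- h"] unfolding K2_def by (simp add: algebra_simps)
    also have "J z h - J z (- h) = 2 * h * deriv (J z) 0 + h\<^sup>2 * (J2 z h - J2 z (- h))"
      using taylor2_eq[of J z h] taylor2_eq[of J z "- h"] unfolding J2_def by (simp add: algebra_simps)
    also have "2 * K z 0 + h\<^sup>2 * (K2 z h + K2 z (- h)) + v z * A z
                 = (2 * a z 0 + v z) * A z + h\<^sup>2 * (K2 z h + K2 z (- h))"
      by (simp add: K_def algebra_simps)
    also have "2 * a z 0 + v z = 0" by (rule diag[OF z])
    finally show "coupled a c v A B z h = 2 * h * (c z 0 * deriv B z + deriv (c z) 0 * B z)
        + h\<^sup>2 * (K2 z h + K2 z (- h) + (J2 z h - J2 z (- h)))"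
      unfolding J1 by (simp add: algebra_simps)
  qed
qed

text \<open>The amplitudes are chosen one pair at a time. If the sum up to \<open>L\<close> leaves the remainders
\<open>h ^ (L + 2) * G\<close> and \<open>h ^ (L + 2) * H\<close>, the next pair has to cancel \<open>G z 0\<close> and \<open>H z 0\<close>. By the previous
lemma this amounts to two separate transport equations, \<open>G\<close> determining \<open>B\<close> and \<open>H\<close> determining \<open>A\<close>.\<close>

lemma formal_solution:
  fixes a b c d :: "complex \<Rightarrow> complex \<Rightarrow> complex" and z0 :: complex and R :: real
  defines "U \<equiv> ball z0 R"
  assumes R: "R > 0" and hol: "holo2 z0 R a" "holo2 z0 R b" "holo2 z0 R c" "holo2 z0 R d"
    and diag: "\<And>z. z \<in> U \<Longrightarrow> 2 * a z 0 + v z = 0" "\<And>z. z \<in> U \<Longrightarrow> 2 * d z 0 + v z = 0"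
    and solA: "\<And>F. F holomorphic_on U \<Longrightarrow> \<exists>f. f holomorphic_on U \<and>
                 (\<forall>z\<in>U. b z 0 * deriv f z + deriv (b z) 0 * f z = F z)"
    and solB: "\<And>F. F holomorphic_on U \<Longrightarrow> \<exists>f. f holomorphic_on U \<and>
                 (\<forall>z\<in>U. c z 0 * deriv f z + deriv (c z) 0 * f z = F z)"
    and A0: "A0 holomorphic_on U" "\<And>z. z \<in> U \<Longrightarrow> b z 0 * deriv A0 z + deriv (b z) 0 * A0 z = 0"
  shows "\<exists>A B. (\<forall>l. A l holomorphic_on U) \<and> (\<forall>l. B l holomorphic_on U) \<and>
     A 0 = A0 \<and> B 0 = (\<lambda>_. 0) \<and>
     (\<forall>L. \<exists>G H. holo2 z0 R G \<and> holo2 z0 R H \<and>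
       (\<forall>z\<in>U. \<forall>h. (\<Sum>l\<le>L. h ^ l * coupled a c v (A l) (B l) z h) = h ^ (L + 2) * G z h \<and>
                  (\<Sum>l\<le>L. h ^ l * coupled d b v (B l) (A l) z h) = h ^ (L + 2) * H z h))"
proof -
  \<comment> \<open>A state consists of the current amplitudes and both remainders divided by \<open>h ^ (n + 2)\<close>.\<close>
  define P where "P n = (\<lambda>(A, B, G, H). A holomorphic_on U \<and> B holomorphic_on U \<and> holo2 z0 R G \<and> holo2 z0 R H \<and>
      (n = (0::nat) \<longrightarrow> A = A0 \<and> B = (\<lambda>_. 0) \<and> (\<forall>z\<in>U. \<forall>h. coupled a c v A B z h = h\<^sup>2 * G z h \<and>
         coupled d b v B A z h = h\<^sup>2 * H z h)))" for n
  define Q where "Q = (\<lambda>(A :: complex \<Rightarrow> complex, B :: complex \<Rightarrow> complex, G, H) (A', B', G', H'). \<forall>z\<in>U. \<forall>h.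
      h * G z h + coupled a c v A' B' z h = h\<^sup>2 * G' z h \<and>
      h * H z h + coupled d b v B' A' z h = h\<^sup>2 * H' z h)"
  have "\<exists>f. \<forall>n. P n (f n) \<and> Q (f n) (f (Suc n))"
  proof (rule dependent_nat_choice)
    have zero: "(\<lambda>_. 0) holomorphic_on ball z0 R" by (rule holomorphic_on_const)
    obtain G where G: "holo2 z0 R G" "\<And>z h. z \<in> U \<Longrightarrow> coupled a c v A0 (\<lambda>_. 0) z h
       = 2 * h * (c z 0 * deriv (\<lambda>_. 0) z + deriv (c z) 0 * 0) + h\<^sup>2 * G z h"
      using coupled_expansion[OF hol(1,3) A0(1)[unfolded U_def] zero diag(1)] unfolding U_def by metis
    obtain H where H: "holo2 z0 R H" "\<And>z h. z \<in> U \<Longrightarrow> coupled d b v (\<lambda>_. 0) A0 z h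
       = 2 * h * (b z 0 * deriv A0 z + deriv (b z) 0 * A0 z) + h\<^sup>2 * H z h"
      using coupled_expansion[OF hol(4,2) zero A0(1)[unfolded U_def] diag(2)] unfolding U_def by metis
    have "P 0 (A0, \<lambda>_. 0, G, H)"
      unfolding P_def prod.case using A0 G H by (auto simp: U_def)
    then show "\<exists>x. P 0 x" ..
  next
    fix x n assume "P n x"
    obtain A B G H where x: "x = (A, B, G, H)" by (metis prod_cases4)
    have G: "holo2 z0 R G" and H: "holo2 z0 R H" using \<open>P n x\<close> unfolding P_def x by auto
    have rhs: "(\<lambda>z. - G z 0 / 2) holomorphic_on U" "(\<lambda>z. - H z 0 / 2) holomorphic_on U"
      unfolding U_def by (intro holomorphic_intros holo2_at_0[OF G R] holo2_at_0[OF H R]; simp)+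
    from solA[OF rhs(2)] obtain A' where A': "A' holomorphic_on U"
        "\<And>z. z \<in> U \<Longrightarrow> b z 0 * deriv A' z + deriv (b z) 0 * A' z = - H z 0 / 2" by blast
    from solB[OF rhs(1)] obtain B' where B': "B' holomorphic_on U"
        "\<And>z. z \<in> U \<Longrightarrow> c z 0 * deriv B' z + deriv (c z) 0 * B' z = - G z 0 / 2" by blast
    obtain G' where G': "holo2 z0 R G'" "\<And>z h. z \<in> U \<Longrightarrow> coupled a c v A' B' z h
       = 2 * h * (c z 0 * deriv B' z + deriv (c z) 0 * B' z) + h\<^sup>2 * G' z h"
      using coupled_expansion[OF hol(1,3) A'(1)[unfolded U_def] B'(1)[unfolded U_def] diag(1)]
      unfolding U_def by metis
    obtain H' where H': "holo2 z0 R H'" "\<And>z h. z \<in> U \<Longrightarrow> coupled d b v B' A' z h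
       = 2 * h * (b z 0 * deriv A' z + deriv (b z) 0 * A' z) + h\<^sup>2 * H' z h"
      using coupled_expansion[OF hol(4,2) B'(1)[unfolded U_def] A'(1)[unfolded U_def] diag(2)]
      unfolding U_def by metis
    have "P (Suc n) (A', B', \<lambda>z h. G' z h + hquot G z h, \<lambda>z h. H' z h + hquot H z h)"
      unfolding P_def prod.case using A' B' G' H' by (auto intro: holo2_add holo2_hquot G H)
    moreover have "Q x (A', B', \<lambda>z h. G' z h + hquot G z h, \<lambda>z h. H' z h + hquot H z h)"
      unfolding Q_def x prod.case
    proof (intro ballI allI conjI)
      fix z h assume z: "z \<in> U"
      show "h * G z h + coupled a c v A' B' z h = h\<^sup>2 * (G' z h + hquot G z h)"
        using hquot_eq[of G z h] unfolding G'(2)[OF z] B'(2)[OF z]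
        by (simp add: algebra_simps power2_eq_square)
      show "h * H z h + coupled d b v B' A' z h = h\<^sup>2 * (H' z h + hquot H z h)"
        using hquot_eq[of H z h] unfolding H'(2)[OF z] A'(2)[OF z]
        by (simp add: algebra_simps power2_eq_square)
    qed
    ultimately show "\<exists>y. P (Suc n) y \<and> Q x y" by blast
  qed
  then obtain f where f: "\<And>n. P n (f n)" "\<And>n. Q (f n) (f (Suc n))" by blast
  define A where "A n = fst (f n)" for n
  define B where "B n = fst (snd (f n))" for n
  define G where "G n = fst (snd (snd (f n)))" for n
  define H where "H n = snd (snd (snd (f n)))" for n
  have fn: "f n = (A n, B n, G n, H n)" for n by (simp add: A_def B_def G_def H_def)
  have base: "A 0 = A0" "B 0 = (\<lambda>_. 0)" 
    "\<And>z h. z \<in> U \<Longrightarrow> coupled a c v (A 0) (B 0) z h = h\<^sup>2 * G 0 z h"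
    "\<And>z h. z \<in> U \<Longrightarrow> coupled d b v (B 0) (A 0) z h = h\<^sup>2 * H 0 z h"
    using f(1)[of 0] unfolding fn P_def by auto
  have all: "A n holomorphic_on U" "B n holomorphic_on U" "holo2 z0 R (G n)" "holo2 z0 R (H n)" for n
    using f(1)[of n] unfolding fn P_def by auto
  have step: "h * G n z h + coupled a c v (A (Suc n)) (B (Suc n)) z h = h\<^sup>2 * G (Suc n) z h"
    "h * H n z h + coupled d b v (B (Suc n)) (A (Suc n)) z h = h\<^sup>2 * H (Suc n) z h"
    if "z \<in> U" for n z h
    using f(2)[of n] that unfolding fn Q_def by auto
  have "(\<Sum>l\<le>L. h ^ l * coupled a c v (A l) (B l) z h) = h ^ (L + 2) * G L z h \<and>
        (\<Sum>l\<le>L. h ^ l * coupled d b v (B l) (A l) z h) = h ^ (L + 2) * H L z h" if z: "z \<in> U" for L z h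
  proof (induction L)
    case 0
    show ?case using base(3,4)[OF z] by (simp add: power2_eq_square)
  next
    case (Suc L)
    have "(\<Sum>l\<le>Suc L. h ^ l * coupled a c v (A l) (B l) z h)
            = h ^ (L + 1) * (h * G L z h + coupled a c v (A (Suc L)) (B (Suc L)) z h)"
      unfolding sum.atMost_Suc using Suc by (simp add: algebra_simps)
    moreover have "(\<Sum>l\<le>Suc L. h ^ l * coupled d b v (B l) (A l) z h)
            = h ^ (L + 1) * (h * H L z h + coupled d b v (B (Suc L)) (A (Suc L)) z h)"
      unfolding sum.atMost_Suc using Suc by (simp add: algebra_simps)
    ultimately show ?case unfolding step[OF z] by (simp add: power2_eq_square mult_ac)
  qed
  with all base show ?thesis by (intro exI[of _ A] exI[of _ B]) blast
qed

section \<open>The phase function\<close>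

text \<open>The inverse of the arc would map a disk injectively into the line, against invariance of dimension.
So the cut disk is dense in the disk, and identities extend over the cut by continuity.\<close>

lemma interior_arc_image_empty:
  assumes "arc (c :: real \<Rightarrow> complex)"
  shows "interior (path_image c) = {}"
proof (rule ccontr)
  assume "interior (path_image c) \<noteq> {}"
  then obtain x e where e: "e > 0" "ball x e \<subseteq> path_image c"
    by (meson all_not_in_conv mem_interior)
  obtain f where f: "homeomorphism {0..1} (path_image c) c f"
    using homeomorphism_arc[OF assms] by blast
  have "aff_dim (ball x e) \<le> aff_dim (UNIV :: real set)"
  proof (rule invariance_of_dimension_convex_domain[of _ f])
    show "continuous_on (ball x e) f"
      using f e(2) continuous_on_subset unfolding homeomorphism_def by blast
    show "inj_on f (ball x e)"
      using f e(2) by (metis homeomorphism_def inj_on_inverseI subset_iff)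
  qed auto
  moreover have "aff_dim (ball x e) = 2" using e(1) by (simp add: aff_dim_open)
  ultimately show False by simp
qed

text \<open>In the cut disk \<open>S' = p\<close>. Differentiating \<open>\<zeta> ^ 3 = - (9/4) * S\<^sup>2\<close> and eliminating \<open>S\<close> gives
\<open>\<zeta> * \<zeta>'\<^sup>2 = - p\<^sup>2\<close>, so \<open>sqrt \<zeta> * \<zeta>'\<close> is \<open>\<plusminus> \<i> * p\<close> and its hyperbolic cosine is \<open>cos p = - v / 2\<close>. The
second conclusion makes the leading term vanish when the operator is applied to the ansatz.\<close>

lemma phase_dispersion:
  fixes z0 :: complex and R :: real
    and v p S \<zeta> :: "complex \<Rightarrow> complex" and c :: "real \<Rightarrow> complex"
  defines "U \<equiv> ball z0 R"
  defines "D \<equiv> U - path_image c"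
  assumes R: "R > 0" and v: "v holomorphic_on U"
    and cut: "cut_along c z0 R"
    and p: "p holomorphic_on D" "\<And>z. z \<in> D \<Longrightarrow> 2 * cos (p z) + v z = 0"
    and S: "integral_from D z0 p S"
    and \<zeta>: "\<zeta> holomorphic_on U" "\<And>z. z \<in> D \<Longrightarrow> \<zeta> z ^ 3 = (3 / (2 * \<i>) * S z) ^ 2"
    and inj: "inj_on \<zeta> U"
    and E: "(\<lambda>z. lin_sol 1 0 (\<zeta> z) 0 (deriv \<zeta> z)) holomorphic_on U"
  shows "\<zeta> z0 = 0" and "z \<in> U \<Longrightarrow> 2 * lin_sol 1 0 (\<zeta> z) 0 (deriv \<zeta> z) + v z = 0"
proof -
  have arc: "arc c" and c0: "z0 \<in> path_image c"
    using cut unfolding cut_along_def by auto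
  have openD: "open D"
    unfolding D_def U_def using arc by (intro open_Diff closed_arc_image) auto
  have DU: "D \<subseteq> U" unfolding D_def by auto
  have dense: "U \<subseteq> closure D"
  proof
    fix z assume z: "z \<in> U"
    have "closure (- path_image c) = UNIV"
      using interior_arc_image_empty[OF arc] by (simp add: closure_complement)
    then have "U \<inter> closure (- path_image c) \<subseteq> closure (U \<inter> - path_image c)"
      by (intro open_Int_closure_subset) (simp add: U_def)
    with z \<open>closure (- path_image c) = UNIV\<close> show "z \<in> closure D"
      by (auto simp: D_def Diff_eq)
  qed
  have z0U: "z0 \<in> U" using R by (simp add: U_def)
  \<comment> \<open>The point \<open>z0\<close> lies on the cut, so the density of \<open>D\<close> makes it a limit point of \<open>D\<close>.\<close>
  have nontriv: "at z0 within D \<noteq> bot"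
  proof -
    have "z0 \<in> closure D" "z0 \<notin> D" using dense z0U c0 by (auto simp: D_def)
    then show ?thesis by (simp add: closure_def trivial_limit_within)
  qed
  have contz: "continuous_on U \<zeta>" by (rule holomorphic_on_imp_continuous_on[OF \<zeta>(1)])
  show zero: "\<zeta> z0 = 0"
  proof -
    have "isCont \<zeta> z0" using contz z0U by (simp add: U_def continuous_on_eq_continuous_at)
    then have "(\<zeta> \<longlongrightarrow> \<zeta> z0) (at z0 within D)"
      unfolding isCont_def by (rule tendsto_within_subset) simp
    then have "((\<lambda>z. \<zeta> z ^ 3) \<longlongrightarrow> \<zeta> z0 ^ 3) (at z0 within D)" by (rule tendsto_power)
    moreover have "((\<lambda>z. \<zeta> z ^ 3) \<longlongrightarrow> 0) (at z0 within D)"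
    proof (rule Lim_transform_eventually)
      have "(S \<longlongrightarrow> 0) (at z0 within D)" using S by (simp add: integral_from_def)
      then have "((\<lambda>z. (3 / (2 * \<i>) * S z) ^ 2) \<longlongrightarrow> (3 / (2 * \<i>) * 0) ^ 2) (at z0 within D)"
        by (intro tendsto_intros)
      then show "((\<lambda>z. (3 / (2 * \<i>) * S z) ^ 2) \<longlongrightarrow> 0) (at z0 within D)" by simp
      show "\<forall>\<^sub>F z in at z0 within D. (3 / (2 * \<i>) * S z) ^ 2 = \<zeta> z ^ 3"
        using \<zeta>(2) by (auto simp: eventually_at_filter)
    qed
    ultimately have "\<zeta> z0 ^ 3 = 0" using tendsto_unique[OF nontriv] by blast
    then show ?thesis by simp
  qed
  have S': "(S has_field_derivative p z) (at z)" if z: "z \<in> D" for z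
  proof -
    obtain e where e: "e > 0" "ball z e \<subseteq> D" using openD z openE by blast
    have "p holomorphic_on ball z e" using p(1) e(2) holomorphic_on_subset by blast
    then obtain T where T: "\<And>x. x \<in> ball z e \<Longrightarrow> (T has_field_derivative p x) (at x within ball z e)"
      using holomorphic_convex_primitive'[of "ball z e" p] by auto
    have eq: "S x = S z + (T x - T z)" if x: "x \<in> ball z e" for x
    proof -
      have seg: "path_image (linepath z x) \<subseteq> ball z e"
        using x e(1) by (simp add: closed_segment_subset)
      have "(p has_contour_integral (S x - S z)) (linepath z x)"
        using S seg e(2) unfolding integral_from_def
        by (metis order.trans pathfinish_linepath pathstart_linepath valid_path_linepath)
      moreover have "(p has_contour_integral (T x - T z)) (linepath z x)"
        using contour_integral_primitive[OF T valid_path_linepath seg] by simp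
      ultimately have "S x - S z = T x - T z" by (rule has_contour_integral_unique)
      then show ?thesis by (simp add: algebra_simps)
    qed
    have "((\<lambda>x. S z + (T x - T z)) has_field_derivative p z) (at z)"
      using T[of z] e(1) by (auto intro!: derivative_eq_intros simp: at_within_open[of z "ball z e"])
    then show ?thesis
      by (rule has_field_derivative_transform_within_open[OF _ open_ball[of z e]])
         (use e(1) in simp, rule eq[symmetric])
  qed
  have onD: "2 * lin_sol 1 0 (\<zeta> z) 0 (deriv \<zeta> z) + v z = 0" if z: "z \<in> D" for z
  proof -
    have zU: "z \<in> U" using z DU by blast
    have dz: "(\<zeta> has_field_derivative deriv \<zeta> z) (at z)"
      using holomorphic_derivI[OF \<zeta>(1) _ zU] by (simp add: U_def)
    have "((\<lambda>z. \<zeta> z ^ 3) has_field_derivative 3 * \<zeta> z ^ 2 * deriv \<zeta> z) (at z)"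
      by (rule derivative_eq_intros dz refl)+ simp
    moreover have "((\<lambda>z. (3 / (2 * \<i>) * S z) ^ 2) has_field_derivative
                     2 * (3 / (2 * \<i>)) ^ 2 * S z * p z) (at z)"
      by (rule derivative_eq_intros S'[OF z] refl)+ (simp add: power2_eq_square)
    then have "((\<lambda>z. \<zeta> z ^ 3) has_field_derivative 2 * (3 / (2 * \<i>)) ^ 2 * S z * p z) (at z)"
      by (rule has_field_derivative_transform_within_open[OF _ openD z]) (simp add: \<zeta>(2))
    ultimately have e: "3 * \<zeta> z ^ 2 * deriv \<zeta> z = 2 * (3 / (2 * \<i>)) ^ 2 * S z * p z"
      by (rule DERIV_unique)
    have i2: "(3 / (2 * \<i>)) ^ 2 = (- 9 / 4 :: complex)" by (simp add: power_divide power_mult_distrib)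
    have "3 * (2 * \<zeta> z ^ 2 * deriv \<zeta> z) = 3 * (- 3 * (S z * p z))"
      using e unfolding i2 by (simp add: field_simps)
    then have d: "2 * \<zeta> z ^ 2 * deriv \<zeta> z = - 3 * (S z * p z)"
      by (simp only: mult_cancel_left) simp
    have s: "4 * \<zeta> z ^ 3 = - 9 * (S z)\<^sup>2" using \<zeta>(2)[OF z] unfolding power_mult_distrib i2 by simp
    have "4 * \<zeta> z ^ 4 * (deriv \<zeta> z)\<^sup>2 = 9 * (S z)\<^sup>2 * (p z)\<^sup>2"
      using d by algebra
    then have "\<zeta> z ^ 3 * (\<zeta> z * (deriv \<zeta> z)\<^sup>2 + (p z)\<^sup>2) = 0"
      using s by algebra
    moreover have "\<zeta> z \<noteq> 0"
      using inj_onD[OF inj, of z z0] zero zU z0U z c0 by (auto simp: D_def)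
    ultimately have "\<zeta> z * (deriv \<zeta> z)\<^sup>2 = - (p z)\<^sup>2"
      by (simp add: add_eq_0_iff2)
    then have "(csqrt (\<zeta> z) * deriv \<zeta> z)\<^sup>2 = (\<i> * p z)\<^sup>2"
      by (simp add: power_mult_distrib)
    then have "csqrt (\<zeta> z) * deriv \<zeta> z = \<i> * p z \<or> csqrt (\<zeta> z) * deriv \<zeta> z = - (\<i> * p z)"
      by (simp add: power2_eq_iff)
    then have "cosh (csqrt (\<zeta> z) * deriv \<zeta> z) = cosh (\<i> * p z)" by auto
    also have "\<dots> = cos (p z)"
      by (simp add: cosh_conv_cos)
    finally show ?thesis
      using p(2)[OF z] lin_sol_10_h0[of "csqrt (\<zeta> z)" "\<zeta> z" "deriv \<zeta> z"] by simp
  qed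
  show "2 * lin_sol 1 0 (\<zeta> z) 0 (deriv \<zeta> z) + v z = 0" if z: "z \<in> U"
  proof -
    define f where "f z = 2 * lin_sol 1 0 (\<zeta> z) 0 (deriv \<zeta> z) + v z" for z
    have "f holomorphic_on U"
      unfolding f_def[abs_def] by (intro holomorphic_intros E v)
    then have "isCont f z"
      using z by (auto simp: U_def continuous_on_eq_continuous_at dest!: holomorphic_on_imp_continuous_on)
    have "f z = 0"
    proof (cases "z \<in> D")
      case True
      then show ?thesis using onD by (simp add: f_def)
    next
      case False
      have "z \<in> closure D" using dense z by blast
      with False have "at z within D \<noteq> bot"
        by (simp add: closure_def trivial_limit_within)
      moreover have "(f \<longlongrightarrow> f z) (at z within D)"
        using \<open>isCont f z\<close> unfolding isCont_def by (rule tendsto_within_subset) simp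
      moreover have "(f \<longlongrightarrow> 0) (at z within D)"
        by (rule Lim_transform_eventually[OF tendsto_const])
           (auto simp: eventually_at_filter f_def onD)
      ultimately show ?thesis using tendsto_unique by blast
    qed
    then show ?thesis by (simp add: f_def)
  qed
qed

section \<open>The difference operator on the ansatz\<close>

definition increment_quot :: "(complex \<Rightarrow> complex) \<Rightarrow> complex \<Rightarrow> complex \<Rightarrow> complex" where
  "increment_quot \<zeta> = hquot (\<lambda>z h. \<zeta> (z + h))"

lemma increment_quot_eq: "\<zeta> (z + h) = \<zeta> z + h * increment_quot \<zeta> z h"
  using hquot_eq[of "\<lambda>z h. \<zeta> (z + h)" z h] by (simp add: increment_quot_def)

lemma increment_quot_0: "increment_quot \<zeta> z 0 = deriv \<zeta> z"
  unfolding increment_quot_def hquot_0 deriv_def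
  by (simp add: DERIV_shift[of \<zeta> _ 0 z, simplified] add.commute)

lemma increment_quot_symmetric: "increment_quot \<zeta> (z + h) (- h) = increment_quot \<zeta> z h"
  by (cases "h = 0") (simp_all add: increment_quot_def hquot_def divide_simps)

text \<open>The coefficient by which a solution \<open>Y\<close> of the linear-potential equation moves the rescaled Airy
function from \<open>z\<close> to \<open>z + h\<close>: the increment of \<open>\<zeta>\<close> is written as \<open>h\<close> times \<open>increment_quot \<zeta> z h\<close>, which
is the running variable \<open>s\<close> at the end of the step.\<close>

definition airy_step :: "(complex \<Rightarrow> complex \<Rightarrow> complex \<Rightarrow> complex) \<Rightarrow> (complex \<Rightarrow> complex) \<Rightarrow>
    complex \<Rightarrow> complex \<Rightarrow> complex" where
  "airy_step Y \<zeta> z h = Y (\<zeta> z) h (increment_quot \<zeta> z h)"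

lemma holo2_airy_step:
  assumes "\<zeta> holomorphic_on ball z0 R"
  shows "holo2 z0 R (airy_step (lin_sol \<alpha> \<beta>) \<zeta>)" "holo2 z0 R (airy_step (lin_sol' \<alpha> \<beta>) \<zeta>)"
proof -
  have "holo2 z0 R (increment_quot \<zeta>)"
    unfolding increment_quot_def by (intro holo2_hquot holo2_shift assms)
  then show "holo2 z0 R (airy_step (lin_sol \<alpha> \<beta>) \<zeta>)" "holo2 z0 R (airy_step (lin_sol' \<alpha> \<beta>) \<zeta>)"
    unfolding airy_step_def[abs_def] by (intro holo2_lin_sol holo2_fst assms; assumption)+
qed

text \<open>The two off-diagonal coefficients of a step agree with those of the step back; this is the
hypothesis of \<open>deriv_symmetric\<close>.\<close>

lemma airy_step_symmetric:
  "airy_step (lin_sol 0 1) \<zeta> (z + h) (- h) = airy_step (lin_sol 0 1) \<zeta> z h"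
  "airy_step (lin_sol' 1 0) \<zeta> (z + h) (- h) = airy_step (lin_sol' 1 0) \<zeta> z h"
  unfolding airy_step_def increment_quot_symmetric increment_quot_eq[of \<zeta> z h] lin_sol_reverse
  by (rule refl)+

text \<open>Since the transport of the Airy values is exact, so is this formula, for every \<open>h > 0\<close>. All
dependence on the choice of \<open>w\<close> is in the two factors in front of the sums.\<close>

lemma diff_op_W_ansatz:
  assumes w: "solves_lin 0 1 w (deriv w)" and h: "h > 0" and B0: "B 0 = (\<lambda>_. 0)"
  shows "diff_op v h (W_ansatz w \<zeta> A B L h) z =
     of_real (h powr (1/3)) * scaled w \<zeta> h z *
       (\<Sum>l\<le>L. of_real h ^ l * coupled (airy_step (lin_sol 1 0) \<zeta>) (airy_step (lin_sol' 1 0) \<zeta>) v (A l) (B l) z (of_real h))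
   + of_real (h powr (2/3)) * scaled (deriv w) \<zeta> h z *
       (\<Sum>l\<le>L. of_real h ^ l * coupled (airy_step (lin_sol' 0 1) \<zeta>) (airy_step (lin_sol 0 1) \<zeta>) v (B l) (A l) z (of_real h))"
proof -
  define k :: complex where "k = of_real (h powr (1/3))"
  define H :: complex where "H = of_real h"
  have k0: "k \<noteq> 0" using h by (simp add: k_def)
  have pw: "of_real (h powr (2/3)) = k\<^sup>2" "H = k ^ 3"
    using h by (simp_all add: k_def H_def powr_power flip: of_real_power)
  have sc: "scaled f \<zeta> h z = f (\<zeta> z / k\<^sup>2)" for f z
    using h by (simp add: scaled_def powr_minus_divide pw(1)[symmetric])
  define SA where "SA z = (\<Sum>l\<le>L. H ^ l * A l z)" for z
  define SB where "SB z = (\<Sum>l\<le>L. H ^ l * B l z)" for z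
  have W: "W_ansatz w \<zeta> A B L h z = k * w (\<zeta> z / k\<^sup>2) * SA z + k\<^sup>2 * deriv w (\<zeta> z / k\<^sup>2) * SB z" for z
  proof -
    have "(\<Sum>l=0..L. of_real (h ^ l) * A l z) = SA z"
      by (simp add: SA_def H_def atMost_atLeast0)
    moreover have "SB z = (\<Sum>l=1..L. of_real (h ^ l) * B l z)"
      unfolding SB_def atMost_atLeast0
      by (subst sum.atLeast_Suc_atMost) (simp_all add: B0 H_def)
    ultimately show ?thesis
      unfolding W_ansatz_def sc pw(1) k_def[symmetric] by simp
  qed
  define a where "a = airy_step (lin_sol 1 0) \<zeta>"
  define b where "b = airy_step (lin_sol 0 1) \<zeta>"
  define c where "c = airy_step (lin_sol' 1 0) \<zeta>"
  define d where "d = airy_step (lin_sol' 0 1) \<zeta>"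
  define w0 where "w0 = w (\<zeta> z / k\<^sup>2)"
  define w1 where "w1 = deriv w (\<zeta> z / k\<^sup>2)"
  \<comment> \<open>Both shifts at once: \<open>\<epsilon> = 1\<close> or \<open>\<epsilon> = - 1\<close>.\<close>
  have step: "W_ansatz w \<zeta> A B L h (z + \<epsilon> * H)
      = k * w0 * (a z (\<epsilon> * H) * SA (z + \<epsilon> * H) + \<epsilon> * c z (\<epsilon> * H) * SB (z + \<epsilon> * H))
      + k\<^sup>2 * w1 * (\<epsilon> * b z (\<epsilon> * H) * SA (z + \<epsilon> * H) + d z (\<epsilon> * H) * SB (z + \<epsilon> * H))"
    if \<epsilon>: "\<epsilon>\<^sup>2 = 1" for \<epsilon>
  proof -
    have "(\<epsilon> * H)\<^sup>2 = k ^ 6" using \<epsilon> by (simp add: power_mult_distrib pw(2) flip: power_mult)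
    note T = airy_transport[OF w k0 this, of "\<zeta> z" "increment_quot \<zeta> z (\<epsilon> * H)", folded increment_quot_eq[of \<zeta> z "\<epsilon> * H"]]
    have q: "\<epsilon> * H / k\<^sup>2 = \<epsilon> * k"
      using k0 by (simp add: pw(2) power2_eq_square power3_eq_cube)
    have T1: "w (\<zeta> (z + \<epsilon> * H) / k\<^sup>2) = a z (\<epsilon> * H) * w0 + \<epsilon> * k * b z (\<epsilon> * H) * w1"
      using T(1) unfolding q a_def b_def airy_step_def w0_def w1_def .
    have T2: "\<epsilon> * k * deriv w (\<zeta> (z + \<epsilon> * H) / k\<^sup>2) = c z (\<epsilon> * H) * w0 + \<epsilon> * k * d z (\<epsilon> * H) * w1"
      using T(2) unfolding q c_def d_def airy_step_def w0_def w1_def .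
    \<comment> \<open>Multiplying the previous equation by \<open>\<epsilon>\<close> and using \<open>\<epsilon>\<^sup>2 = 1\<close> moves the sign to the off-diagonal term.\<close>
    have T3: "k * deriv w (\<zeta> (z + \<epsilon> * H) / k\<^sup>2) = \<epsilon> * c z (\<epsilon> * H) * w0 + k * d z (\<epsilon> * H) * w1"
    proof -
      have "k * deriv w (\<zeta> (z + \<epsilon> * H) / k\<^sup>2) = \<epsilon>\<^sup>2 * (k * deriv w (\<zeta> (z + \<epsilon> * H) / k\<^sup>2))"
        by (simp add: \<epsilon>)
      also have "\<dots> = \<epsilon> * (\<epsilon> * k * deriv w (\<zeta> (z + \<epsilon> * H) / k\<^sup>2))"
        by (simp add: power2_eq_square)
      also have "\<dots> = \<epsilon> * c z (\<epsilon> * H) * w0 + \<epsilon>\<^sup>2 * (k * d z (\<epsilon> * H) * w1)"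
        unfolding T2 by (simp add: algebra_simps power2_eq_square)
      finally show ?thesis by (simp add: \<epsilon>)
    qed
    have "W_ansatz w \<zeta> A B L h (z + \<epsilon> * H)
        = k * w (\<zeta> (z + \<epsilon> * H) / k\<^sup>2) * SA (z + \<epsilon> * H) + k * (k * deriv w (\<zeta> (z + \<epsilon> * H) / k\<^sup>2)) * SB (z + \<epsilon> * H)"
      unfolding W by (simp add: power2_eq_square)
    then show ?thesis unfolding T1 T3 by (simp add: algebra_simps power2_eq_square)
  qed
  have co: "(\<Sum>l\<le>L. H ^ l * coupled a' c' v (A' l) (B' l) z H)
      = (\<Sum>l\<le>L. H ^ l * A' l (z + H)) * a' z H + (\<Sum>l\<le>L. H ^ l * A' l (z - H)) * a' z (- H)
        + v z * (\<Sum>l\<le>L. H ^ l * A' l z)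
        + ((\<Sum>l\<le>L. H ^ l * B' l (z + H)) * c' z H - (\<Sum>l\<le>L. H ^ l * B' l (z - H)) * c' z (- H))"
    for a' c' and A' B' :: "nat \<Rightarrow> complex \<Rightarrow> complex"
    unfolding coupled_def sum_distrib_left sum_distrib_right
      sum_subtractf[symmetric] sum.distrib[symmetric]
    by (intro sum.cong refl) (simp add: algebra_simps)
  have "diff_op v h (W_ansatz w \<zeta> A B L h) z
      = W_ansatz w \<zeta> A B L h (z + 1 * H) + W_ansatz w \<zeta> A B L h (z + (- 1) * H)
        + v z * W_ansatz w \<zeta> A B L h z"
    by (simp add: diff_op_def H_def)
  also have "\<dots> = k * w0 * (SA (z + H) * a z H + SA (z - H) * a z (- H) + v z * SA z
                       + (SB (z + H) * c z H - SB (z - H) * c z (- H)))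
      + k\<^sup>2 * w1 * (SB (z + H) * d z H + SB (z - H) * d z (- H) + v z * SB z
                       + (SA (z + H) * b z H - SA (z - H) * b z (- H)))"
    by (subst (1 2) step) (simp_all add: W w0_def[symmetric] w1_def[symmetric] algebra_simps)
  finally show ?thesis
    unfolding sc pw(1) k_def[symmetric] H_def[symmetric] a_def[symmetric] b_def[symmetric]
      c_def[symmetric] d_def[symmetric] w0_def[symmetric] w1_def[symmetric] co SA_def[symmetric] SB_def[symmetric] .
qed

section \<open>The remainder estimate\<close>

text \<open>Shrinking the disk from \<open>R\<close> to \<open>r\<close> leaves room for all steps up to \<open>(R - r) / 2\<close>; there the remainder
divided by \<open>h ^ (L + 2)\<close> is bounded.\<close>

lemma unif_O_remainder:
  assumes G: "holo2 z0 R G" and r: "r \<in> {0<..<R}"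
    and F: "\<And>z h. z \<in> ball z0 R \<Longrightarrow> F z h = h ^ (L + 2) * G z h"
  shows "unif_O (shift_dom (ball z0 r))
           (\<lambda>h z. of_real (h powr e) * s h z * F z (of_real h))
           (\<lambda>h z. of_real (h powr (real L + 2 + e)) * s h z)"
proof -
  define \<rho> where "\<rho> = (R - r) / 2"
  have \<rho>: "\<rho> > 0" "r + \<rho> < R" using r by (auto simp: \<rho>_def field_simps)
  obtain M where M: "M > 0" "\<And>z h. z \<in> cball z0 r \<Longrightarrow> h \<in> cball 0 \<rho> \<Longrightarrow> norm (G z h) \<le> M"
    using holo2_bound[OF G \<rho>(2)] by metis
  show ?thesis unfolding unif_O_def
  proof (rule exI[of _ M], intro conjI M(1) exI[of _ \<rho>] \<rho>(1) ballI)
    fix h z assume h: "h \<in> {0<..<\<rho>}" and z: "z \<in> shift_dom (ball z0 r) h"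
    have z': "z \<in> ball z0 r" "z \<in> ball z0 R" using z r by (auto simp: shift_dom_def)
    have pw: "h powr (real L + 2 + e) = h ^ (L + 2) * h powr e"
    proof -
      have "real L + 2 + e = real (L + 2) + e" by simp
      moreover have "h powr real (L + 2) = h ^ (L + 2)" using h by (intro powr_realpow) auto
      ultimately show ?thesis by (simp only: powr_add)
    qed
    have "norm (G z (of_real h)) \<le> M" using z' h by (intro M(2)) auto
    then have "(h ^ (L + 2) * h powr e * norm (s h z)) * norm (G z (of_real h))
                 \<le> (h ^ (L + 2) * h powr e * norm (s h z)) * M"
      using h by (intro mult_left_mono) auto
    then show "norm (of_real (h powr e) * s h z * F z (of_real h))
          \<le> M * norm (of_real (h powr (real L + 2 + e)) * s h z)"
      using h unfolding F[OF z'(2)] pw by (simp add: norm_mult norm_power mult_ac)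
  qed
qed

theorem theorem1p3:
  fixes z0 :: complex and R :: real
    and v p S \<zeta> sg :: "complex \<Rightarrow> complex" and c :: "real \<Rightarrow> complex"
  defines "U \<equiv> ball z0 R"
  defines "D \<equiv> U - path_image c"
  assumes "R > 0"
    and "v analytic_on U" and "v z0 = -2" and "deriv v z0 \<noteq> 0"
    and "\<And>z. z \<in> U - {z0} \<Longrightarrow> v z \<noteq> 2 \<and> v z \<noteq> -2"
    and "cut_along c z0 R"
    and "p analytic_on D" and "\<And>z. z \<in> D \<Longrightarrow> 2 * cos (p z) + v z = 0"
    and "(p \<longlongrightarrow> 0) (at z0 within D)"
    and "integral_from D z0 p S"
    and "\<zeta> analytic_on U" and "\<And>z. z \<in> D \<Longrightarrow> \<zeta> z ^ 3 = (3 / (2 * \<i>) * S z) ^ 2"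
    and "inj_on \<zeta> U"
    and "\<And>z. z \<in> U \<Longrightarrow> g_fun \<zeta> z \<noteq> 0"
    and "sg analytic_on U" and "\<And>z. z \<in> U \<Longrightarrow> sg z ^ 2 = g_fun \<zeta> z"
  shows "\<exists>A B :: nat \<Rightarrow> complex \<Rightarrow> complex.
    (\<forall>l. A l analytic_on U) \<and> (\<forall>l\<ge>1. B l analytic_on U) \<and>
    (\<forall>z\<in>U. A 0 z = 1 / sg z) \<and>
    (\<forall>L. \<forall>j\<in>{0, 1, 2}. \<forall>r\<in>{0<..<R}.
       unif_O_sum (shift_dom (ball z0 r))
         (\<lambda>h. diff_op v h (W_ansatz (airy_w j) \<zeta> A B L h))
         (\<lambda>h z. of_real (h powr (real L + 2 + 1/3)) * scaled (airy_w j) \<zeta> h z)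
         (\<lambda>h z. of_real (h powr (real L + 2 + 2/3)) * scaled (deriv (airy_w j)) \<zeta> h z))"
proof -
  have openU: "open U" by (simp add: U_def)
  have vh: "v holomorphic_on U" and zh: "\<zeta> holomorphic_on U" and sgh: "sg holomorphic_on U"
    using assms(4,13,17) by (auto intro: analytic_imp_holomorphic)
  have ph: "p holomorphic_on D" using assms(9) by (rule analytic_imp_holomorphic)
  have sgnz: "sg z \<noteq> 0" if "z \<in> U" for z using assms(16,18)[OF that] by auto
  define a where "a = airy_step (lin_sol 1 0) \<zeta>"
  define b where "b = airy_step (lin_sol 0 1) \<zeta>"
  define c' where "c' = airy_step (lin_sol' 1 0) \<zeta>"
  define d where "d = airy_step (lin_sol' 0 1) \<zeta>"
  have hol: "holo2 z0 R a" "holo2 z0 R b" "holo2 z0 R c'" "holo2 z0 R d"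
    unfolding a_def b_def c'_def d_def by (rule holo2_airy_step[OF zh[unfolded U_def]])+
  have a0: "a z 0 = lin_sol 1 0 (\<zeta> z) 0 (deriv \<zeta> z)" for z
    by (simp add: a_def airy_step_def increment_quot_0)
  have E: "(\<lambda>z. lin_sol 1 0 (\<zeta> z) 0 (deriv \<zeta> z)) holomorphic_on U"
    using holo2_at_0[OF hol(1) \<open>R > 0\<close>] unfolding a0 U_def .
  note prem = \<open>R > 0\<close> vh assms(8) ph assms(10,12) zh assms(14,15) E
  note V = phase_dispersion[of R v z0 c p S \<zeta>, folded U_def, folded D_def]
  have V1: "\<zeta> z0 = 0"
    by (rule V(1)) (use prem in blast)+
  have V2: "2 * lin_sol 1 0 (\<zeta> z) 0 (deriv \<zeta> z) + v z = 0" if "z \<in> U" for z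
    by (rule V(2)) (use prem that in blast)+
  have diag: "2 * a z 0 + v z = 0" "2 * d z 0 + v z = 0" if "z \<in> U" for z
    using V2[OF that] by (simp_all add: a0 d_def airy_step_def increment_quot_0 lin_sol_h0)
  have b0: "b z 0 = (sg z)\<^sup>2" if "z \<in> U" for z
    using assms(18)[OF that] by (simp add: b_def airy_step_def increment_quot_0 g_fun_eq_lin_sol)
  have c0: "c' z 0 = \<zeta> z * (sg z)\<^sup>2" if "z \<in> U" for z
    using b0[OF that] by (simp add: b_def c'_def airy_step_def increment_quot_0 lin_sol_h0)
  have b1: "deriv (b z) 0 = deriv (\<lambda>z. b z 0) z / 2" if "z \<in> U" for z
    using deriv_symmetric[OF hol(2)] airy_step_symmetric(1) that unfolding b_def U_def by simp
  have c1: "deriv (c' z) 0 = deriv (\<lambda>z. c' z 0) z / 2" if "z \<in> U" for z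
    using deriv_symmetric[OF hol(3)] airy_step_symmetric(2) that unfolding c'_def U_def by simp
  obtain \<kappa> where \<kappa>: "\<kappa> holomorphic_on U" "\<And>z. z \<in> U \<Longrightarrow> \<kappa> z \<noteq> 0"
      "\<And>z. z \<in> U \<Longrightarrow> \<zeta> z = (z - z0) * (\<kappa> z)\<^sup>2"
    using zero_factor_sqrt[OF zh[unfolded U_def] assms(15)[unfolded U_def] \<open>R > 0\<close> V1]
    unfolding U_def by blast
  \<comment> \<open>The amplitudes \<open>A\<close> are transported with the coefficient \<open>g\<close>, which has no zeros; the amplitudes \<open>B\<close> with \<open>\<zeta> * g\<close>, which has a simple zero at \<open>z0\<close>.\<close>
  have solA: "\<exists>f. f holomorphic_on U \<and> (\<forall>z\<in>U. b z 0 * deriv f z + deriv (b z) 0 * f z = F z)"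
    if hF: "F holomorphic_on U" for F
  proof -
    have "\<exists>f. f holomorphic_on U \<and> (\<forall>z\<in>U. b z 0 * deriv f z + deriv (\<lambda>z. b z 0) z / 2 * f z = F z)"
      unfolding U_def by (rule transport_regular[of sg]) (use sgh sgnz b0 hF in \<open>auto simp: U_def\<close>)
    then show ?thesis by (simp only: b1 cong: ball_cong)
  qed
  have solB: "\<exists>f. f holomorphic_on U \<and> (\<forall>z\<in>U. c' z 0 * deriv f z + deriv (c' z) 0 * f z = F z)"
    if hF: "F holomorphic_on U" for F
  proof -
    have "\<exists>f. f holomorphic_on U \<and> (\<forall>z\<in>U. c' z 0 * deriv f z + deriv (\<lambda>z. c' z 0) z / 2 * f z = F z)"
      unfolding U_def
    proof (rule transport_singular[of "\<lambda>z. \<kappa> z * sg z"])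
      show "(\<lambda>z. \<kappa> z * sg z) holomorphic_on ball z0 R"
        using \<kappa>(1) sgh unfolding U_def by (intro holomorphic_intros)
      show "F holomorphic_on ball z0 R" using hF by (simp add: U_def)
      fix z assume "z \<in> ball z0 R"
      then have "z \<in> U" by (simp add: U_def)
      then show "\<kappa> z * sg z \<noteq> 0" "c' z 0 = (z - z0) * (\<kappa> z * sg z)\<^sup>2"
        using \<kappa>(2,3) sgnz c0 by (simp_all add: power_mult_distrib)
    qed
    then show ?thesis by (simp only: c1 cong: ball_cong)
  qed
  have A0: "(\<lambda>z. 1 / sg z) holomorphic_on U" by (intro holomorphic_intros sgh sgnz)
  have A0eq: "b z 0 * deriv (\<lambda>z. 1 / sg z) z + deriv (b z) 0 * (1 / sg z) = 0" if "z \<in> U" for z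
    using transport_eq[of U z "\<lambda>_. 1" sg "\<lambda>_. 1" "\<lambda>z. b z 0"] openU that sgh sgnz b0 by (simp add: b1[OF that])
  have "\<exists>A B. (\<forall>l. A l holomorphic_on U) \<and> (\<forall>l. B l holomorphic_on U) \<and>
     A 0 = (\<lambda>z. 1 / sg z) \<and> B 0 = (\<lambda>_. 0) \<and>
     (\<forall>L. \<exists>G H. holo2 z0 R G \<and> holo2 z0 R H \<and>
       (\<forall>z\<in>U. \<forall>h. (\<Sum>l\<le>L. h ^ l * coupled a c' v (A l) (B l) z h) = h ^ (L + 2) * G z h \<and>
                  (\<Sum>l\<le>L. h ^ l * coupled d b v (B l) (A l) z h) = h ^ (L + 2) * H z h))"
    by (rule formal_solution[of R z0 a b c' d v "\<lambda>z. 1 / sg z", folded U_def])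
       (fact \<open>R > 0\<close> hol diag solA solB A0 A0eq)+
  then obtain A B where AB: "\<And>l. A l holomorphic_on U" "\<And>l. B l holomorphic_on U"
      "A 0 = (\<lambda>z. 1 / sg z)" "B 0 = (\<lambda>_. 0)"
    and rem: "\<And>L. \<exists>G H. holo2 z0 R G \<and> holo2 z0 R H \<and>
       (\<forall>z\<in>U. \<forall>h. (\<Sum>l\<le>L. h ^ l * coupled a c' v (A l) (B l) z h) = h ^ (L + 2) * G z h \<and>
                  (\<Sum>l\<le>L. h ^ l * coupled d b v (B l) (A l) z h) = h ^ (L + 2) * H z h)"
    by blast
  have "unif_O_sum (shift_dom (ball z0 r))
         (\<lambda>h. diff_op v h (W_ansatz (airy_w j) \<zeta> A B L h))
         (\<lambda>h z. of_real (h powr (real L + 2 + 1/3)) * scaled (airy_w j) \<zeta> h z)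
         (\<lambda>h z. of_real (h powr (real L + 2 + 2/3)) * scaled (deriv (airy_w j)) \<zeta> h z)"
    if r: "r \<in> {0<..<R}" for L j r
  proof -
    define X where "X z h = (\<Sum>l\<le>L. h ^ l * coupled a c' v (A l) (B l) z h)" for z h
    define Y where "Y z h = (\<Sum>l\<le>L. h ^ l * coupled d b v (B l) (A l) z h)" for z h
    obtain G H where G: "holo2 z0 R G" "\<And>z h. z \<in> ball z0 R \<Longrightarrow> X z h = h ^ (L + 2) * G z h"
      and H: "holo2 z0 R H" "\<And>z h. z \<in> ball z0 R \<Longrightarrow> Y z h = h ^ (L + 2) * H z h"
      using rem[of L] unfolding X_def Y_def U_def by blast
    show ?thesis unfolding unif_O_sum_def
    proof (intro exI conjI)
      show "\<forall>h>0. \<forall>z\<in>shift_dom (ball z0 r) h. diff_op v h (W_ansatz (airy_w j) \<zeta> A B L h) z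
          = of_real (h powr (1/3)) * scaled (airy_w j) \<zeta> h z * X z (of_real h)
          + of_real (h powr (2/3)) * scaled (deriv (airy_w j)) \<zeta> h z * Y z (of_real h)"
        unfolding X_def Y_def a_def b_def c'_def d_def
        by (intro allI impI ballI diff_op_W_ansatz airy_ode AB(4))
      show "unif_O (shift_dom (ball z0 r))
          (\<lambda>h z. of_real (h powr (1/3)) * scaled (airy_w j) \<zeta> h z * X z (of_real h))
          (\<lambda>h z. of_real (h powr (real L + 2 + 1/3)) * scaled (airy_w j) \<zeta> h z)"
        by (rule unif_O_remainder[OF G(1) r G(2)])
      show "unif_O (shift_dom (ball z0 r))
          (\<lambda>h z. of_real (h powr (2/3)) * scaled (deriv (airy_w j)) \<zeta> h z * Y z (of_real h))
          (\<lambda>h z. of_real (h powr (real L + 2 + 2/3)) * scaled (deriv (airy_w j)) \<zeta> h z)"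
        by (rule unif_O_remainder[OF H(1) r H(2)])
    qed
  qed
  then show ?thesis
    using AB openU by (intro exI[of _ A] exI[of _ B]) (auto simp: analytic_on_open)
qed

end
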